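(* Let $X$ be a reflexive Banach space with finite cotype and let $T:X\to X$ be an $R$-Ritt operator. Then for any $\alpha,\beta>0$ there is $C\ge1$ such that $C^{-1}\|x\|_{T,\alpha}\le\|x\|_{T,\beta}\le C\|x\|_{T,\alpha}$ for all $x\in X$.
   Context: Let $(\varepsilon_k)_{k\ge1}$ be independent Rademacher variables on a probability space $\Omega_0$ and $\mathrm{Rad}(X)$ the closure in $L^2(\Omega_0;X)$ of the span of $\{\varepsilon_k\otimes x\}$. $F\subset B(X)$ is $R$-bounded if there is $C$ with $\|\sum_k\varepsilon_k\otimes T_kx_k\|_{\mathrm{Rad}(X)}\le C\|\sum_k\varepsilon_k\otimes x_k\|_{\mathrm{Rad}(X)}$ for all finite families $T_k\in F$, $x_k\in X$. $T$ is $R$-Ritt if $\{T^n:n\ge0\}$ and $\{n(T^n-T^{n-1}):n\ge1\}$ are $R$-bounded; then $I-T$ is sectorial and $(I-T)^\alpha$ is its fractional power. For $x\in X$ and $\alpha>0$, $\|x\|_{T,\alpha}=\|\sum_{k\ge1}k^{\alpha-\frac12}\varepsilon_k\otimes T^{k-1}(I-T)^\alpha x\|_{\mathrm{Rad}(X)}$ if this series converges in $L^2(\Omega_0;X)$, and $\infty$ otherwise. *)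

theory Defs
  imports "HOL-Analysis.Analysis"
begin

text \<open>Norm in Rad(X) of the finite Rademacher sum over k in K of eps_k tensor y k:
  the L2-norm, i.e. the square root of the average over all sign choices.\<close>
definition rad_norm :: "nat set \<Rightarrow> (nat \<Rightarrow> 'a::real_normed_vector) \<Rightarrow> real" where
  "rad_norm K y =
     sqrt ((\<Sum>s\<in>PiE K (\<lambda>_. {-1::real, 1}). (norm (\<Sum>k\<in>K. s k *\<^sub>R y k))\<^sup>2)
           / 2 ^ card K)"

definition R_bounded :: "('a::real_normed_vector \<Rightarrow> 'a) set \<Rightarrow> bool" where
  "R_bounded F \<longleftrightarrow> (\<exists>C. \<forall>(n::nat) (Ts::nat \<Rightarrow> 'a \<Rightarrow> 'a) (xs::nat \<Rightarrow> 'a).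
      (\<forall>k<n. Ts k \<in> F) \<longrightarrow>
      rad_norm {..<n} (\<lambda>k. Ts k (xs k)) \<le> C * rad_norm {..<n} xs)"

definition R_Ritt :: "('a::real_normed_vector \<Rightarrow> 'a) \<Rightarrow> bool" where
  "R_Ritt T \<longleftrightarrow> bounded_linear T
     \<and> R_bounded (range (\<lambda>n. T ^^ n))
     \<and> R_bounded ((\<lambda>n. \<lambda>x. real n *\<^sub>R ((T ^^ n) x - (T ^^ (n - 1)) x)) ` {1..})"

definition finite_cotype :: "'a::real_normed_vector itself \<Rightarrow> bool" where
  "finite_cotype _ \<longleftrightarrow> (\<exists>q::real. \<exists>C. 2 \<le> q \<and> (\<forall>(n::nat) (xs::nat \<Rightarrow> 'a).
      (\<Sum>k<n. norm (xs k) powr q) powr (1 / q) \<le> C * rad_norm {..<n} xs))"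

definition reflexive_space :: "'a::real_normed_vector itself \<Rightarrow> bool" where
  "reflexive_space _ \<longleftrightarrow>
     (\<forall>\<Phi> :: ('a \<Rightarrow>\<^sub>L real) \<Rightarrow>\<^sub>L real. \<exists>x::'a. \<forall>f. blinfun_apply \<Phi> f = blinfun_apply f x)"

text \<open>Balakrishnan formula for A^theta, 0 < theta < 1, of a (bounded) sectorial operator A:
  A^theta x = sin(pi theta)/pi * integral over (0,\<infinity>) of t^(theta-1) A (t + A)^(-1) x dt.\<close>
definition balakrishnan :: "('a::banach \<Rightarrow> 'a) \<Rightarrow> real \<Rightarrow> 'a \<Rightarrow> 'a" where
  "balakrishnan A \<theta> x = (sin (pi * \<theta>) / pi) *\<^sub>R
     integral {0<..} (\<lambda>t. t powr (\<theta> - 1) *\<^sub>R A (inv (\<lambda>y. t *\<^sub>R y + A y) x))"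

definition frac_power :: "('a::banach \<Rightarrow> 'a) \<Rightarrow> real \<Rightarrow> 'a \<Rightarrow> 'a" where
  "frac_power A \<alpha> x =
     (if \<alpha> = of_int \<lfloor>\<alpha>\<rfloor> then (A ^^ nat \<lfloor>\<alpha>\<rfloor>) x
      else (A ^^ nat \<lfloor>\<alpha>\<rfloor>) (balakrishnan A (\<alpha> - of_int \<lfloor>\<alpha>\<rfloor>) x))"

text \<open>Cauchy criterion in L2(Omega0;X) for the Rademacher series sum_{k\<ge>1} eps_k tensor y k.\<close>
definition rad_cauchy :: "(nat \<Rightarrow> 'a::real_normed_vector) \<Rightarrow> bool" where
  "rad_cauchy y \<longleftrightarrow> (\<forall>e>0. \<exists>M\<ge>1. \<forall>m n. M \<le> m \<longrightarrow> m \<le> n \<longrightarrow> rad_norm {m..n} y < e)"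

definition sq_norm :: "('a::banach \<Rightarrow> 'a) \<Rightarrow> real \<Rightarrow> 'a \<Rightarrow> ereal" where
  "sq_norm T \<alpha> x =
     (let y = (\<lambda>k. real k powr (\<alpha> - 1/2) *\<^sub>R (T ^^ (k - 1)) (frac_power (\<lambda>z. z - T z) \<alpha> x))
      in if rad_cauchy y then ereal (lim (\<lambda>N. rad_norm {1..N} y)) else \<infinity>)"

end

theory Submission
  imports Defs
begin

text \<open>
  Write \<open>A = I - T\<close>. Balakrishnan's integral agrees with the binomial series in \<open>T\<close>, so the fractional
  powers of \<open>A\<close> form a semigroup. Raising the exponent by one costs a factor \<open>m T^j A\<close> with \<open>j\<close> about
  \<open>m / 2\<close>, which is R-bounded. For lowering it, \<open>T^n A^b x\<close> is a series in \<open>T^(n+k) A^c x\<close> whose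
  coefficients are those of \<open>(1 - z)^(b-c)\<close>. In terms of the square functions this is an upper triangular
  scalar matrix dominated by the Hardy kernel \<open>m^(b-1/2) k^(-b-1/2)\<close>, \<open>k \<ge> m\<close>. Such matrices act
  boundedly on Rad(X) for every X: summing disjoint blocks of length \<open>N\<close> costs only a factor of order
  \<open>sqrt N\<close>, and the kernel splits into averages of block sums with \<open>N = 2^r\<close> and norm of order \<open>2^(-r b)\<close>.
\<close>

section \<open>Rademacher norms of finite sums\<close>

text \<open>The square root in the block estimate is decisive. Where \<open>k\<close> is of order
  \<open>N m\<close>, the kernel has size \<open>N^(-b-1/2) / m\<close>, and there are
  \<open>m\<close> blocks of length \<open>N\<close>. Bounding block sums termwise, at cost
  \<open>N\<close>, would leave \<open>N^(1/2-b)\<close>, which is not summable over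
  \<open>N = 2^r\<close> when b \<le> 1/2. The cost \<open>sqrt N\<close> leaves
  \<open>N^(-b)\<close>, which suffices for every b > 0. Lowering an exponent fits under the Hardy
  kernel only if the drop \<open>d\<close> is at least 1: the diagonal entry of the matrix is
  \<open>m^(-d)\<close>, while that of the kernel is \<open>m^(-1)\<close>. The passage from one
  exponent to another therefore overshoots: integer steps upward go beyond the target, and the way
  back consists of one drop in \<open>[1, 2)\<close> and drops of exactly 1.\<close>

abbreviation signs :: "nat set \<Rightarrow> (nat \<Rightarrow> real) set" where
  "signs K \<equiv> PiE K (\<lambda>_. {-1, 1})"

lemma finite_signs: "finite K \<Longrightarrow> finite (signs K)"
  by (rule finite_PiE) auto

lemma card_signs: "finite K \<Longrightarrow> card (signs K) = 2 ^ card K"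
  by (simp add: card_PiE numeral_2_eq_2)

lemma sign_cases: "s \<in> signs K \<Longrightarrow> k \<in> K \<Longrightarrow> s k = 1 \<or> s k = -1"
  by (auto simp: PiE_iff)

lemma rad_norm_L2_set:
  "rad_norm K y = L2_set (\<lambda>s. norm (\<Sum>k\<in>K. s k *\<^sub>R y k)) (signs K) / sqrt (2 ^ card K)"
  by (simp add: rad_norm_def L2_set_def real_sqrt_divide)

lemma rad_norm_power2:
  "(rad_norm K y)\<^sup>2 = (\<Sum>s\<in>signs K. (norm (\<Sum>k\<in>K. s k *\<^sub>R y k))\<^sup>2) / 2 ^ card K"
  by (simp add: rad_norm_def sum_nonneg)

lemma rad_norm_nonneg [simp]: "0 \<le> rad_norm K y"
  by (simp add: rad_norm_def sum_nonneg)

lemma rad_norm_cong: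
  assumes "\<And>k. k \<in> K \<Longrightarrow> y k = z k"
  shows "rad_norm K y = rad_norm K z"
proof -
  have "(\<Sum>k\<in>K. s k *\<^sub>R y k) = (\<Sum>k\<in>K. s k *\<^sub>R z k)" for s :: "nat \<Rightarrow> real"
    using assms by (intro sum.cong) auto
  then show ?thesis by (simp add: rad_norm_def)
qed

lemma rad_norm_zero [simp]: "rad_norm K (\<lambda>_. 0) = 0"
  by (simp add: rad_norm_def)

lemma rad_norm_add: "rad_norm K (\<lambda>k. y k + z k) \<le> rad_norm K y + rad_norm K z"
proof -
  have "L2_set (\<lambda>s. norm (\<Sum>k\<in>K. s k *\<^sub>R (y k + z k))) (signs K)
      \<le> L2_set (\<lambda>s. norm (\<Sum>k\<in>K. s k *\<^sub>R y k) + norm (\<Sum>k\<in>K. s k *\<^sub>R z k)) (signs K)"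
    by (intro L2_set_mono) (auto simp: scaleR_add_right sum.distrib intro: norm_triangle_ineq)
  also have "\<dots> \<le> L2_set (\<lambda>s. norm (\<Sum>k\<in>K. s k *\<^sub>R y k)) (signs K)
      + L2_set (\<lambda>s. norm (\<Sum>k\<in>K. s k *\<^sub>R z k)) (signs K)"
    by (rule L2_set_triangle_ineq)
  finally show ?thesis
    by (simp add: rad_norm_L2_set divide_right_mono flip: add_divide_distrib)
qed

lemma rad_norm_sum:
  assumes "finite I"
  shows "rad_norm K (\<lambda>k. \<Sum>i\<in>I. y i k) \<le> (\<Sum>i\<in>I. rad_norm K (y i))"
  using assms
proof (induction I rule: finite_induct)
  case (insert i I)
  have "rad_norm K (\<lambda>k. \<Sum>j\<in>insert i I. y j k) = rad_norm K (\<lambda>k. y i k + (\<Sum>j\<in>I. y j k))"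
    using insert.hyps by simp
  also have "\<dots> \<le> rad_norm K (y i) + rad_norm K (\<lambda>k. \<Sum>j\<in>I. y j k)"
    by (rule rad_norm_add)
  finally show ?case using insert by simp
qed simp

lemma rad_norm_scaleR: "rad_norm K (\<lambda>k. c *\<^sub>R y k) = \<bar>c\<bar> * rad_norm K y"
proof -
  have "norm (\<Sum>k\<in>K. s k *\<^sub>R c *\<^sub>R y k) = \<bar>c\<bar> * norm (\<Sum>k\<in>K. s k *\<^sub>R y k)" for s :: "nat \<Rightarrow> real"
  proof -
    have "(\<Sum>k\<in>K. s k *\<^sub>R c *\<^sub>R y k) = c *\<^sub>R (\<Sum>k\<in>K. s k *\<^sub>R y k)"
      by (simp add: scaleR_sum_right mult.commute)
    then show ?thesis by simp
  qed
  then show ?thesis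
    by (simp add: rad_norm_L2_set L2_set_right_distrib)
qed

section \<open>Sign symmetry and the contraction principle\<close>

lemma rad_norm_flip:
  assumes "\<And>k. k \<in> K \<Longrightarrow> t k = 1 \<or> t k = -1"
  shows "rad_norm K (\<lambda>k. t k *\<^sub>R y k) = rad_norm K y"
proof -
  \<comment> \<open>Multiplication by \<open>t\<close> is an involution of \<open>signs K\<close>,
    so it only permutes the terms of the average. The restriction to \<open>K\<close> keeps
    \<open>h s\<close> extensional, as membership in \<open>PiE\<close> demands.\<close>
  define h where "h = (\<lambda>s::nat\<Rightarrow>real. restrict (\<lambda>k. s k * t k) K)"
  have hh: "h (h s) = s" if "s \<in> signs K" for s
  proof
    fix k
    show "h (h s) k = s k"
    proof (cases "k \<in> K")
      case True
      then have "t k * t k = 1"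
        using assms[OF True] by auto
      then show ?thesis
        using True by (simp add: h_def)
    next
      case False
      then show ?thesis
        using PiE_arb[OF that False] by (simp add: h_def)
    qed
  qed
  have hS: "h s \<in> signs K" if "s \<in> signs K" for s
  proof -
    have "s k * t k \<in> {-1, 1}" if "k \<in> K" for k
      using sign_cases[OF \<open>s \<in> signs K\<close> that] assms[OF that] by auto
    then show ?thesis
      by (auto simp: h_def)
  qed
  have "(\<Sum>s\<in>signs K. (norm (\<Sum>k\<in>K. s k *\<^sub>R t k *\<^sub>R y k))\<^sup>2)
      = (\<Sum>s\<in>signs K. (norm (\<Sum>k\<in>K. s k *\<^sub>R y k))\<^sup>2)"
    by (rule sum.reindex_bij_witness[where i = h and j = h])
      (simp_all add: hh hS, simp add: h_def mult_ac cong: sum.cong)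
  then show ?thesis by (simp add: rad_norm_def)
qed

text \<open>For |c| \<le> 1 the changed family is the convex combination, with weights
  \<open>(1 + c) / 2\<close> and \<open>(1 - c) / 2\<close>, of \<open>y\<close> and of
  \<open>y\<close> with the sign at \<open>j\<close> reversed; these two have the same norm.\<close>

lemma rad_norm_contraction1:
  assumes "j \<in> K" "\<bar>c\<bar> \<le> 1"
  shows "rad_norm K (y(j := c *\<^sub>R y j)) \<le> rad_norm K y"
proof -
  define t where "t = (\<lambda>k. if k = j then -1 else (1::real))"
  define z where "z = y(j := c *\<^sub>R y j)"
  have eq: "z = (\<lambda>k. ((1 + c) / 2) *\<^sub>R y k + ((1 - c) / 2) *\<^sub>R (t k *\<^sub>R y k))"
    by (rule ext) (auto simp: z_def t_def algebra_simps simp flip: scaleR_add_left scaleR_diff_left, 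
        simp_all add: field_simps flip: scaleR_add_left scaleR_left_diff_distrib)
  have "rad_norm K z \<le> ((1 + c) / 2) * rad_norm K y
      + ((1 - c) / 2) * rad_norm K (\<lambda>k. t k *\<^sub>R y k)"
    unfolding eq using assms(2)
    by (intro order.trans[OF rad_norm_add]) (simp only: rad_norm_scaleR, simp)
  also have "rad_norm K (\<lambda>k. t k *\<^sub>R y k) = rad_norm K y"
    by (rule rad_norm_flip) (auto simp: t_def)
  finally have "rad_norm K z \<le> ((1 + c) / 2 + (1 - c) / 2) * rad_norm K y"
    by (simp only: distrib_right)
  also have "(1 + c) / 2 + (1 - c) / 2 = 1"
    by (simp add: field_simps)
  finally have "rad_norm K z \<le> rad_norm K y"
    by (simp only: mult_1)
  then show ?thesis
    unfolding z_def .
qed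

text \<open>Kahane's contraction principle for real multipliers. After division by \<open>C\<close>
  the coordinates are treated one at a time; \<open>C = 0\<close> is set apart because of this
  division.\<close>

lemma rad_norm_contraction:
  fixes y :: "nat \<Rightarrow> 'a::real_normed_vector"
  assumes "finite K" "\<And>k. k \<in> K \<Longrightarrow> \<bar>c k\<bar> \<le> C" "0 \<le> C"
  shows "rad_norm K (\<lambda>k. c k *\<^sub>R y k) \<le> C * rad_norm K y"
proof (cases "C = 0")
  case True
  then have "rad_norm K (\<lambda>k. c k *\<^sub>R y k) = rad_norm K (\<lambda>k. 0 :: 'a)"
    using assms(2) True by (intro rad_norm_cong) force
  then show ?thesis using True by simp
next
  case False
  with assms(3) have C: "C > 0" by simp
  define d where "d k = c k / C" for k
  have d: "\<bar>d k\<bar> \<le> 1" if "k \<in> K" for k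
    using assms(2)[OF that] C by (simp add: d_def)
  have "J \<subseteq> K \<Longrightarrow> rad_norm K (\<lambda>k. if k \<in> J then d k *\<^sub>R y k else y k) \<le> rad_norm K y"
    if "finite J" for J
    using that
  proof (induction J rule: finite_induct)
    case (insert j J)
    let ?z = "\<lambda>k. if k \<in> J then d k *\<^sub>R y k else y k"
    have "(\<lambda>k. if k \<in> insert j J then d k *\<^sub>R y k else y k) = ?z(j := d j *\<^sub>R ?z j)"
      using insert.hyps by (auto simp: fun_eq_iff)
    then show ?case
      using rad_norm_contraction1[of j K "d j" ?z] d[of j] insert by auto
  qed simp
  from this[OF assms(1)] have "rad_norm K (\<lambda>k. d k *\<^sub>R y k) \<le> rad_norm K y"
    by (simp cong: rad_norm_cong)
  moreover have "rad_norm K (\<lambda>k. c k *\<^sub>R y k) = rad_norm K (\<lambda>k. C *\<^sub>R d k *\<^sub>R y k)"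
    using C by (simp add: d_def)
  ultimately show ?thesis
    using C by (simp only: rad_norm_scaleR abs_of_pos mult_left_mono less_imp_le)
qed

text \<open>Each sign pattern on \<open>K\<close> has two extensions to \<open>j\<close>, with equal
  sums because \<open>y j = 0\<close>; the normalisation absorbs the factor 2.\<close>

lemma rad_norm_insert_zero:
  assumes "finite K" "j \<notin> K" "y j = 0"
  shows "rad_norm (insert j K) y = rad_norm K y"
proof -
  have "(\<Sum>s\<in>signs (insert j K). (norm (\<Sum>k\<in>insert j K. s k *\<^sub>R y k))\<^sup>2)
     = (\<Sum>(c, s)\<in>{-1, 1} \<times> signs K. (norm (\<Sum>k\<in>insert j K. (s(j := c)) k *\<^sub>R y k))\<^sup>2)"
    unfolding PiE_insert_eq using assms(2)
    by (subst sum.reindex[OF inj_combinator]) (auto simp: case_prod_unfold)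
  also have "\<dots> = (\<Sum>(c, s)\<in>{-1, 1::real} \<times> signs K. (norm (\<Sum>k\<in>K. s k *\<^sub>R y k))\<^sup>2)"
  proof -
    have "(\<Sum>k\<in>insert j K. (s(j := c)) k *\<^sub>R y k) = (\<Sum>k\<in>K. s k *\<^sub>R y k)" for s c
      using assms by (auto intro!: sum.cong)
    then show ?thesis by simp
  qed
  also have "\<dots> = 2 * (\<Sum>s\<in>signs K. (norm (\<Sum>k\<in>K. s k *\<^sub>R y k))\<^sup>2)"
    by (subst sum.cartesian_product[symmetric]) simp
  finally show ?thesis using assms by (simp add: rad_norm_def)
qed

lemma rad_norm_superset:
  assumes "finite K'" "K \<subseteq> K'" "\<And>k. k \<in> K' - K \<Longrightarrow> y k = 0"
  shows "rad_norm K' y = rad_norm K y"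
proof -
  have "J \<subseteq> K' - K \<Longrightarrow> rad_norm (J \<union> K) y = rad_norm K y" if "finite J" for J
    using that
  proof (induction J rule: finite_induct)
    case (insert j J)
    then show ?case
      using assms rad_norm_insert_zero[of "J \<union> K" j y] by (auto dest: finite_subset)
  qed simp
  from this[of "K' - K"] show ?thesis using assms by (simp add: Un_absorb2)
qed

lemma rad_norm_mono:
  assumes "finite K'" "K \<subseteq> K'"
  shows "rad_norm K y \<le> rad_norm K' y"
proof -
  have "rad_norm K y = rad_norm K (\<lambda>k. (if k \<in> K then 1 else 0) *\<^sub>R y k)"
    by (rule rad_norm_cong) auto
  also have "\<dots> = rad_norm K' (\<lambda>k. (if k \<in> K then 1 else 0) *\<^sub>R y k)"
    using assms by (intro rad_norm_superset[symmetric]) auto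
  also have "\<dots> \<le> 1 * rad_norm K' y"
    using assms by (intro rad_norm_contraction) auto
  finally show ?thesis by simp
qed

lemma rad_norm_reindex:
  assumes "inj_on f K"
  shows "rad_norm (f ` K) y = rad_norm K (\<lambda>k. y (f k))"
proof -
  have "(\<Sum>s\<in>signs (f ` K). (norm (\<Sum>k\<in>f ` K. s k *\<^sub>R y k))\<^sup>2)
      = (\<Sum>s\<in>signs K. (norm (\<Sum>k\<in>K. s k *\<^sub>R y (f k)))\<^sup>2)"
  proof (rule sum.reindex_bij_witness[where
        i = "\<lambda>s. restrict (\<lambda>l. s (the_inv_into K f l)) (f ` K)" and
        j = "\<lambda>s. restrict (\<lambda>k. s (f k)) K"], goal_cases)
    case (1 s)
    then show ?case
      by (auto simp: fun_eq_iff the_inv_into_f_f[OF assms] PiE_iff extensional_def restrict_def)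
  next
    case (2 s)
    then show ?case by (auto simp: PiE_iff)
  next
    case (3 s)
    then show ?case
      by (auto simp: fun_eq_iff the_inv_into_f_f[OF assms] PiE_iff extensional_def restrict_def)
  next
    case (4 s)
    then show ?case by (auto simp: PiE_iff the_inv_into_f_f[OF assms])
  next
    case (5 s)
    then show ?case using assms by (auto simp: sum.reindex intro!: sum.cong)
  qed
  then show ?thesis by (simp add: rad_norm_def card_image[OF assms])
qed

lemma tendsto_rad_norm:
  assumes "\<And>k. k \<in> K \<Longrightarrow> ((\<lambda>n. y n k) \<longlongrightarrow> z k) F"
  shows "((\<lambda>n. rad_norm K (y n)) \<longlongrightarrow> rad_norm K z) F"
  unfolding rad_norm_def by (intro tendsto_intros assms) auto

lemma rad_norm_singleton: "rad_norm {j} y = norm (y j)"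
proof -
  have "signs {j} = (\<lambda>c. (\<lambda>k\<in>{j}. c)) ` {-1, 1}"
    by (rule set_eqI) (auto simp: PiE_iff fun_eq_iff extensional_def image_iff restrict_def)
  moreover have "(\<lambda>k\<in>{j}. -1) \<noteq> (\<lambda>k\<in>{j}. 1::real)"
    by (auto simp: fun_eq_iff)
  ultimately show ?thesis by (simp add: rad_norm_def)
qed

section \<open>Block sums and the Hardy kernel\<close>

text \<open>Independence of the signs before normalisation.\<close>

lemma sum_signs_prod:
  fixes h :: "nat \<Rightarrow> real \<Rightarrow> 'b::comm_ring_1"
  assumes "finite K"
  shows "(\<Sum>s\<in>signs K. \<Prod>k\<in>K. h k (s k)) = (\<Prod>k\<in>K. h k 1 + h k (-1))"
proof -
  have "(\<Sum>s\<in>signs K. \<Prod>k\<in>K. h k (s k)) = (\<Prod>k\<in>K. \<Sum>c\<in>{-1, 1}. h k c)"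
    using assms by (subst prod_sum_PiE) auto
  then show ?thesis by (simp add: add.commute)
qed

text \<open>A real Riesz product: it is bounded by 2 when \<open>a = 1 / sqrt N\<close> with \<open>N\<close> at least the size of \<open>B\<close>, and its
  correlation with each sign in \<open>B\<close> is exactly \<open>a\<close>. Averaging against it reproduces a block sum from
  the Rademacher sum at the cost of a factor \<open>2 sqrt N\<close>.\<close>
definition riesz :: "real \<Rightarrow> nat set \<Rightarrow> (nat \<Rightarrow> real) \<Rightarrow> real" where
  "riesz a B s = Im (\<Prod>l\<in>B. Complex 1 (a * s l))"

text \<open>By independence each coordinate is averaged alone. For \<open>l\<close> in
  \<open>B\<close> other than \<open>j\<close> the factor \<open>1 + i a s_l\<close> has mean 1, the
  factor at \<open>j\<close> times \<open>s_j\<close> has mean \<open>i a\<close>, and coordinates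
  outside \<open>B\<close> contribute mean 1. The complex mean is thus \<open>i a\<close>, which is
  why \<open>riesz\<close> takes an imaginary part.\<close>

lemma sum_riesz_mult:
  assumes "finite U" "B \<subseteq> U" "j \<in> B"
  shows "(\<Sum>s\<in>signs U. riesz a B s * s j) = 2 ^ card U * a"
proof -
  define h where "h l t = (if l \<in> B then if l = j then Complex 1 (a * t) * of_real t
     else Complex 1 (a * t) else 1)" for l t
  have finB: "finite B" using assms finite_subset by blast
  have "riesz a B s * s j = Im (\<Prod>l\<in>U. h l (s l))" for s
  proof -
    have "(\<Prod>l\<in>U. h l (s l)) = (\<Prod>l\<in>B. h l (s l))"
      using assms by (intro prod.mono_neutral_right) (auto simp: h_def)
    also have "\<dots> = h j (s j) * (\<Prod>l\<in>B - {j}. h l (s l))"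
      using finB assms by (simp add: prod.remove)
    also have "(\<Prod>l\<in>B - {j}. h l (s l)) = (\<Prod>l\<in>B - {j}. Complex 1 (a * s l))"
      by (intro prod.cong) (auto simp: h_def)
    also have "h j (s j) = Complex 1 (a * s j) * of_real (s j)"
      using assms by (simp add: h_def)
    also have "Complex 1 (a * s j) * of_real (s j) * (\<Prod>l\<in>B - {j}. Complex 1 (a * s l))
        = of_real (s j) * (\<Prod>l\<in>B. Complex 1 (a * s l))"
      using finB assms by (simp add: prod.remove[of B j] mult_ac)
    finally show ?thesis by (simp add: riesz_def)
  qed
  then have "(\<Sum>s\<in>signs U. riesz a B s * s j) = Im (\<Sum>s\<in>signs U. \<Prod>l\<in>U. h l (s l))"
    by simp
  also have "\<dots> = Im (\<Prod>l\<in>U. h l 1 + h l (-1))"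
    using assms by (simp add: sum_signs_prod)
  also have "(\<Prod>l\<in>U. h l 1 + h l (-1)) = (\<Prod>l\<in>U. if l = j then Complex 0 (2 * a) else 2)"
    using assms by (intro prod.cong) (auto simp: h_def complex_eq_iff)
  also have "\<dots> = Complex 0 (2 * a) * 2 ^ (card U - 1)"
    using assms by (subst prod.remove[of U j]) auto
  also have "(2::complex) ^ (card U - 1) = of_real (2 ^ (card U - 1))"
    by simp
  finally have "(\<Sum>s\<in>signs U. riesz a B s * s j) = 2 * 2 ^ (card U - 1) * a"
    by (simp add: mult_ac del: of_real_power)
  moreover have "card U > 0" using assms by (auto simp: card_gt_0_iff)
  ultimately show ?thesis by (simp flip: power_Suc)
qed

text \<open>Every factor has modulus \<open>sqrt (1 + 1/N)\<close>, so the product is at most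
  \<open>(1 + 1/N)^(N/2)\<close>, which is bounded by \<open>sqrt e\<close>.\<close>

lemma abs_riesz_le:
  assumes "s \<in> signs U" "B \<subseteq> U" "card B \<le> N" "N > 0" "a = 1 / sqrt (real N)"
  shows "\<bar>riesz a B s\<bar> \<le> 2"
proof -
  have "cmod (Complex 1 (a * s l)) = sqrt (1 + 1 / real N)" if "l \<in> B" for l
  proof -
    have "s l = 1 \<or> s l = -1" using sign_cases[OF assms(1)] that assms(2) by auto
    then have "(a * s l)\<^sup>2 = 1 / real N"
      using assms by (auto simp: power_divide)
    then show ?thesis by (simp add: cmod_def)
  qed
  then have "cmod (\<Prod>l\<in>B. Complex 1 (a * s l)) = sqrt (1 + 1 / real N) ^ card B"
    by (simp flip: prod_norm)
  also have "\<dots> \<le> sqrt (1 + 1 / real N) ^ N"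
    using assms by (intro power_increasing) auto
  also have "\<dots> = sqrt ((1 + 1 / real N) ^ N)"
    by (simp add: real_sqrt_power)
  also have "\<dots> \<le> sqrt 4"
  proof -
    have "(1 + 1 / real N) ^ N \<le> exp 1"
      using assms(4) by (intro exp_ge_one_plus_x_over_n_power_n) auto
    also have "exp 1 \<le> (4::real)" using exp_le by linarith
    finally have "(1 + 1 / real N) ^ N \<le> 4" .
    then show ?thesis by (rule real_sqrt_le_mono)
  qed
  finally have "cmod (\<Prod>l\<in>B. Complex 1 (a * s l)) \<le> 2" by simp
  then show ?thesis
    unfolding riesz_def using abs_Im_le_cmod order.trans by blast
qed

text \<open>For fixed auxiliary signs \<open>s\<close> the Riesz weights are scalars bounded by 2,
  which the contraction principle removes. Cauchy-Schwarz compares the average over \<open>s\<close>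
  of the remaining norms with their quadratic mean. Since the blocks are disjoint, the products of
  \<open>t m\<close> and \<open>s k\<close>, with \<open>k\<close> in \<open>B m\<close>, again run
  through all sign patterns on the union, so the outer signs disappear.\<close>

lemma rad_norm_block_sums:
  fixes z :: "nat \<Rightarrow> 'a::real_normed_vector"
  assumes M: "finite M" and B: "\<And>m. m \<in> M \<Longrightarrow> finite (B m)" "\<And>m. m \<in> M \<Longrightarrow> card (B m) \<le> N"
    and disj: "disjoint_family_on B M" and N: "N > 0"
  shows "rad_norm M (\<lambda>m. \<Sum>k\<in>B m. z k) \<le> 2 * sqrt N * rad_norm (\<Union>m\<in>M. B m) z"
proof -
  define U where "U = (\<Union>m\<in>M. B m)"
  define a where "a = 1 / sqrt (real N)"
  \<comment> \<open>\<open>c\<close> normalises the correlation \<open>2 ^ card U * a\<close> of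
    \<open>sum_riesz_mult\<close> to 1.\<close>
  define c where "c = 1 / (a * 2 ^ card U)"
  define Z where "Z s m = (\<Sum>k\<in>B m. s k *\<^sub>R z k)" for s :: "nat \<Rightarrow> real" and m
  define \<mu> where "\<mu> k = (THE m. m \<in> M \<and> k \<in> B m)" for k
  have \<mu>: "\<mu> k = m" if "m \<in> M" "k \<in> B m" for m k
    unfolding \<mu>_def using that disj by (intro the_equality) (auto simp: disjoint_family_on_def)
  have U: "finite U" "\<And>m. m \<in> M \<Longrightarrow> B m \<subseteq> U"
    using M B by (auto simp: U_def)
  have a: "a > 0" using N by (simp add: a_def)
  then have c: "c > 0" by (simp add: c_def)
  have "rad_norm M (\<lambda>m. \<Sum>k\<in>B m. z k)
      = rad_norm M (\<lambda>m. \<Sum>s\<in>signs U. c *\<^sub>R riesz a (B m) s *\<^sub>R Z s m)"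
  proof (rule rad_norm_cong)
    fix m assume m: "m \<in> M"
    have "(\<Sum>s\<in>signs U. c *\<^sub>R riesz a (B m) s *\<^sub>R Z s m)
        = (\<Sum>s\<in>signs U. \<Sum>k\<in>B m. (c * (riesz a (B m) s * s k)) *\<^sub>R z k)"
      by (simp add: Z_def scaleR_sum_right mult_ac)
    also have "\<dots> = (\<Sum>k\<in>B m. (c * (\<Sum>s\<in>signs U. riesz a (B m) s * s k)) *\<^sub>R z k)"
      by (subst sum.swap) (simp add: sum_distrib_left scaleR_sum_left)
    also have "\<dots> = (\<Sum>k\<in>B m. z k)"
      using U m a by (intro sum.cong) (simp_all add: sum_riesz_mult c_def)
    finally show "(\<Sum>k\<in>B m. z k) = (\<Sum>s\<in>signs U. c *\<^sub>R riesz a (B m) s *\<^sub>R Z s m)" ..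
  qed
  also have "\<dots> \<le> (\<Sum>s\<in>signs U. c * (2 * rad_norm M (Z s)))"
  proof (intro order.trans[OF rad_norm_sum] sum_mono)
    fix s assume s: "s \<in> signs U"
    have "rad_norm M (\<lambda>m. riesz a (B m) s *\<^sub>R Z s m) \<le> 2 * rad_norm M (Z s)"
      using s U B N a_def M by (intro rad_norm_contraction abs_riesz_le) auto
    then show "rad_norm M (\<lambda>m. c *\<^sub>R riesz a (B m) s *\<^sub>R Z s m) \<le> c * (2 * rad_norm M (Z s))"
      using c by (simp only: rad_norm_scaleR abs_of_pos mult_left_mono less_imp_le)
  qed (simp add: U finite_signs)
  also have "\<dots> = 2 * c * (\<Sum>s\<in>signs U. rad_norm M (Z s))"
    by (simp add: sum_distrib_left mult_ac)
  also have "(\<Sum>s\<in>signs U. rad_norm M (Z s)) \<le> 2 ^ card U * rad_norm U z"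
  proof (rule power2_le_imp_le)
    have inner: "(\<Sum>s\<in>signs U. (norm (\<Sum>m\<in>M. t m *\<^sub>R Z s m))\<^sup>2) = 2 ^ card U * (rad_norm U z)\<^sup>2"
      if t: "t \<in> signs M" for t
    proof -
      have "(\<Sum>m\<in>M. t m *\<^sub>R Z s m) = (\<Sum>k\<in>U. s k *\<^sub>R t (\<mu> k) *\<^sub>R z k)" for s :: "nat \<Rightarrow> real"
        unfolding U_def using M B disj
        by (subst sum.UNION_disjoint)
          (auto simp: disjoint_family_on_def Z_def scaleR_sum_right \<mu> mult_ac intro!: sum.cong)
      then have "(\<Sum>s\<in>signs U. (norm (\<Sum>m\<in>M. t m *\<^sub>R Z s m))\<^sup>2)
          = 2 ^ card U * (rad_norm U (\<lambda>k. t (\<mu> k) *\<^sub>R z k))\<^sup>2"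
        by (simp add: rad_norm_power2)
      also have "rad_norm U (\<lambda>k. t (\<mu> k) *\<^sub>R z k) = rad_norm U z"
      proof (rule rad_norm_flip)
        fix k assume "k \<in> U"
        then obtain m where "m \<in> M" "k \<in> B m" by (auto simp: U_def)
        then show "t (\<mu> k) = 1 \<or> t (\<mu> k) = -1"
          using sign_cases[OF t] \<mu> by simp
      qed
      finally show ?thesis .
    qed
    have "(\<Sum>s\<in>signs U. rad_norm M (Z s))\<^sup>2 \<le> (\<Sum>s\<in>signs U. (rad_norm M (Z s))\<^sup>2) * 2 ^ card U"
      using sum_squared_le_sum_of_squares[of "\<lambda>s. rad_norm M (Z s)" "signs U"] U
      by (simp add: card_signs mult.commute)
    also have "(\<Sum>s\<in>signs U. (rad_norm M (Z s))\<^sup>2)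
        = (\<Sum>t\<in>signs M. \<Sum>s\<in>signs U. (norm (\<Sum>m\<in>M. t m *\<^sub>R Z s m))\<^sup>2) / 2 ^ card M"
      by (subst sum.swap) (simp add: rad_norm_power2 sum_divide_distrib)
    also have "\<dots> = 2 ^ card U * (rad_norm U z)\<^sup>2"
      using M by (simp add: inner card_signs)
    finally show "(\<Sum>s\<in>signs U. rad_norm M (Z s))\<^sup>2 \<le> (2 ^ card U * rad_norm U z)\<^sup>2"
      by (simp add: power2_eq_square mult_ac)
  qed simp
  also have "2 * c * (2 ^ card U * rad_norm U z) = 2 * sqrt N * rad_norm U z"
    by (simp add: c_def a_def)
  finally show ?thesis
    using c by (simp add: U_def)
qed

text \<open>Disjointness makes the weight a function of \<open>k\<close> alone. It can be absorbed
  into \<open>y\<close> before the block sums are taken and is then removed by the contraction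
  principle.\<close>

lemma rad_norm_weighted_block_sums:
  assumes M: "finite M" and B: "\<And>m. m \<in> M \<Longrightarrow> finite (B m)" "\<And>m. m \<in> M \<Longrightarrow> card (B m) \<le> N"
    and disj: "disjoint_family_on B M" and N: "N > 0"
    and w: "\<And>m k. m \<in> M \<Longrightarrow> k \<in> B m \<Longrightarrow> \<bar>w m k\<bar> \<le> W" "0 \<le> W"
  shows "rad_norm M (\<lambda>m. \<Sum>k\<in>B m. w m k *\<^sub>R y k)
      \<le> 2 * sqrt N * W * rad_norm (\<Union>m\<in>M. B m) y"
proof -
  define \<mu> where "\<mu> k = (THE m. m \<in> M \<and> k \<in> B m)" for k
  have \<mu>: "\<mu> k = m" if "m \<in> M" "k \<in> B m" for m k
    unfolding \<mu>_def using that disj by (intro the_equality) (auto simp: disjoint_family_on_def)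
  have "rad_norm M (\<lambda>m. \<Sum>k\<in>B m. w m k *\<^sub>R y k)
      = rad_norm M (\<lambda>m. \<Sum>k\<in>B m. w (\<mu> k) k *\<^sub>R y k)"
    by (intro rad_norm_cong sum.cong) (auto simp: \<mu>)
  also have "\<dots> \<le> 2 * sqrt N * rad_norm (\<Union>m\<in>M. B m) (\<lambda>k. w (\<mu> k) k *\<^sub>R y k)"
    by (rule rad_norm_block_sums) (use assms in auto)
  also have "\<dots> \<le> 2 * sqrt N * (W * rad_norm (\<Union>m\<in>M. B m) y)"
    using M B w by (intro mult_left_mono rad_norm_contraction) (auto simp: \<mu>)
  finally show ?thesis by (simp add: mult_ac)
qed

lemma sum_consecutive_blocks:
  fixes f :: "nat \<Rightarrow> 'a::comm_monoid_add"
  assumes "mono u"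
  shows "(\<Sum>i<n. \<Sum>k\<in>{u i..<u (Suc i)}. f k) = (\<Sum>k\<in>{u 0..<u n}. f k)"
proof (induction n)
  case (Suc n)
  have "u 0 \<le> u n" "u n \<le> u (Suc n)" using assms by (auto intro: monoD)
  then show ?case using Suc by (simp add: sum.atLeastLessThan_concat)
qed simp

text \<open>Each \<open>i < m\<close> equals \<open>j * m div L\<close> for exactly
  \<open>L / m\<close> indices \<open>j < L\<close>. A range that depends on \<open>m\<close> is
  thereby replaced by one common to all divisors \<open>m\<close> of \<open>L\<close>.\<close>

lemma sum_div_scaled:
  fixes g :: "nat \<Rightarrow> 'a::real_vector"
  assumes "m dvd L" "L > 0"
  shows "(\<Sum>i<m. g i) = (\<Sum>j<L. (real m / real L) *\<^sub>R g (j * m div L))"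
proof -
  from assms obtain q where L: "L = m * q" and q: "q > 0" and m: "m > 0" by auto
  have "(\<Sum>j<L. (real m / real L) *\<^sub>R g (j * m div L)) = (\<Sum>j<m * q. (1 / real q) *\<^sub>R g (j div q))"
    using m by (simp add: L mult.commute[of _ m])
  also have "\<dots> = (\<Sum>i<m. \<Sum>j\<in>{i * q..<i * q + q}. (1 / real q) *\<^sub>R g (j div q))"
    by (rule sum.nat_group[symmetric])
  also have "\<dots> = (\<Sum>i<m. \<Sum>j\<in>{i * q..<i * q + q}. (1 / real q) *\<^sub>R g i)"
  proof (intro sum.cong refl)
    fix i j assume "j \<in> {i * q..<i * q + q}"
    then have "j div q = i"
      by (intro div_nat_eqI) (auto simp: mult.commute)
    then show "(1 / real q) *\<^sub>R g (j div q) = (1 / real q) *\<^sub>R g i" by simp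
  qed
  also have "\<dots> = (\<Sum>i<m. g i)"
    using q by (simp add: sum_constant_scaleR)
  finally show ?thesis ..
qed

text \<open>For \<open>m \<le> n\<close> the interval from \<open>N m\<close> to \<open>2 N m\<close> is cut into blocks of length \<open>N\<close>. Indexing the blocks
  by \<open>j < n!\<close> instead of \<open>i < m\<close> makes the sum an average, uniform in \<open>m\<close>, over families in which distinct
  \<open>m\<close> pick disjoint blocks.\<close>
lemma rad_norm_dyadic_piece:
  assumes b: "b > 0" and D: "D \<ge> 0" and N: "N > 0" and m0: "m0 > 0"
    and a: "\<And>m k. 0 < m \<Longrightarrow> m \<le> k \<Longrightarrow> \<bar>a m k\<bar> \<le> D * real m powr (b - 1/2) * real k powr (- b - 1/2)"
    and y: "\<And>k. k > K \<Longrightarrow> y k = 0"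
  shows "rad_norm {m0..n} (\<lambda>m. \<Sum>k\<in>{N * m..<2 * N * m}. a m k *\<^sub>R y k)
      \<le> 2 * D * real N powr - b * rad_norm {m0..K} y"
proof -
  define L :: nat where "L = fact n"
  define p where "p j m = m + j * m div L" for j m
  define B where "B j m = {N * p j m..<N * Suc (p j m)}" for j m
  define W where "W = D * real N powr (- b - 1/2)"
  have L: "L > 0" by (simp add: L_def)
  \<comment> \<open>\<open>j * m div L\<close> alone is only nondecreasing in \<open>m\<close>; the
    summand \<open>m\<close> makes the block number strictly increasing.\<close>
  have p_mono: "p j m < p j m'" if "m < m'" for j m m'
    using that div_le_mono[of "j * m" "j * m'" L] by (simp add: p_def add_less_le_mono)
  have card_B: "card (B j m) = N" for j m by (simp add: B_def)
  have B_disj: "disjoint_family_on (B j) {m0..n}" for j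
    unfolding disjoint_family_on_def
  proof (intro ballI impI)
    have *: "B j m \<inter> B j m' = {}" if "m < m'" for m m'
    proof -
      have "N * Suc (p j m) \<le> N * p j m'" using p_mono[OF that, of j] by (intro mult_le_mono2) simp
      then show ?thesis by (auto simp: B_def)
    qed
    fix m m' :: nat assume "m \<noteq> m'"
    then show "B j m \<inter> B j m' = {}" using *[of m m'] *[of m' m] by (cases "m < m'") auto
  qed
  have B_ge: "N * m \<le> k" if "k \<in> B j m" for j m k
  proof -
    have "N * m \<le> N * p j m" by (intro mult_le_mono2) (simp add: p_def)
    also have "N * p j m \<le> k" using that by (simp add: B_def)
    finally show ?thesis .
  qed
  \<comment> \<open>The factor \<open>m\<close> is the number of blocks, left over when their sum
    becomes an average over \<open>j < L\<close>. It balances the kernel: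
    \<open>m * m^(b-1/2) * (N m)^(-b-1/2) = N^(-b-1/2)\<close>, independent of
    \<open>m\<close>.\<close>
  have weight: "\<bar>real m * a m k\<bar> \<le> W" if "k \<in> B j m" "m \<in> {m0..n}" for j m k
  proof -
    have m: "m > 0" and k: "N * m \<le> k" using that m0 B_ge by auto
    have "m \<le> N * m" using N by simp
    with k have "m \<le> k" by linarith
    then have "\<bar>real m * a m k\<bar> \<le> real m * (D * real m powr (b - 1/2) * real k powr (- b - 1/2))"
      using a[of m k] m by (simp add: abs_mult mult_left_mono)
    also have "\<dots> = D * real m powr (b + 1/2) * real k powr (- b - 1/2)"
      using m by (simp add: powr_mult_base add.commute)
    also have "\<dots> \<le> D * real m powr (b + 1/2) * real (N * m) powr (- b - 1/2)"
      using k m N b D by (intro mult_left_mono powr_mono2') (auto simp flip: of_nat_mult)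
    also have "\<dots> = W * (real m powr (b + 1/2) * real m powr (- b - 1/2))"
      by (simp add: W_def powr_mult)
    also have "real m powr (b + 1/2) * real m powr (- b - 1/2) = 1"
      using m by (simp flip: powr_add)
    finally show ?thesis by simp
  qed
  have "rad_norm {m0..n} (\<lambda>m. \<Sum>k\<in>{N * m..<2 * N * m}. a m k *\<^sub>R y k)
      = rad_norm {m0..n} (\<lambda>m. \<Sum>j<L. (1 / real L) *\<^sub>R (\<Sum>k\<in>B j m. (real m * a m k) *\<^sub>R y k))"
  proof (rule rad_norm_cong)
    fix m assume m: "m \<in> {m0..n}"
    define g where "g i = (\<Sum>k\<in>{N * (m + i)..<N * Suc (m + i)}. a m k *\<^sub>R y k)" for i
    have "m dvd L" using m m0 by (auto simp: L_def intro: dvd_fact)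
    have "(\<Sum>k\<in>{N * m..<2 * N * m}. a m k *\<^sub>R y k) = (\<Sum>i<m. g i)"
    proof -
      have "2 * N * m = N * (m + m)" by simp
      moreover have "mono (\<lambda>i. N * (m + i))" by (simp add: mono_def)
      ultimately show ?thesis
        using sum_consecutive_blocks[of "\<lambda>i. N * (m + i)" "\<lambda>k. a m k *\<^sub>R y k" m]
        unfolding g_def by (simp only: add_0_right add_Suc_right)
    qed
    also have "\<dots> = (\<Sum>j<L. (real m / real L) *\<^sub>R g (j * m div L))"
      by (rule sum_div_scaled) fact+
    also have "\<dots> = (\<Sum>j<L. (1 / real L) *\<^sub>R (\<Sum>k\<in>B j m. (real m * a m k) *\<^sub>R y k))"
      by (simp add: g_def B_def p_def scaleR_sum_right)
    finally show "(\<Sum>k\<in>{N * m..<2 * N * m}. a m k *\<^sub>R y k)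
      = (\<Sum>j<L. (1 / real L) *\<^sub>R (\<Sum>k\<in>B j m. (real m * a m k) *\<^sub>R y k))" .
  qed
  also have "\<dots> \<le> (\<Sum>j<L. (1 / real L) * (2 * sqrt N * W * rad_norm {m0..K} y))"
  proof (intro order.trans[OF rad_norm_sum] sum_mono)
    fix j
    let ?U = "\<Union>m\<in>{m0..n}. B j m"
    have "?U \<subseteq> {m0..}"
    proof
      fix k assume "k \<in> ?U"
      then obtain m where m: "m \<ge> m0" "k \<in> B j m" by auto
      have "m \<le> N * m" using N by simp
      then show "k \<in> {m0..}" using m(1) B_ge[OF m(2)] unfolding atLeast_iff by linarith
    qed
    have "rad_norm {m0..n} (\<lambda>m. \<Sum>k\<in>B j m. (real m * a m k) *\<^sub>R y k)
        \<le> 2 * sqrt N * W * rad_norm ?U y"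
      using weight D N B_disj
      by (intro rad_norm_weighted_block_sums) (auto simp: card_B, auto simp: B_def W_def)
    \<comment> \<open>Blocks may extend beyond \<open>K\<close>, where \<open>y\<close>
      vanishes.\<close>
    also have "rad_norm ?U y = rad_norm (?U \<inter> {m0..K}) y"
    proof (rule rad_norm_superset)
      show "finite ?U" by (simp add: B_def)
      fix k assume "k \<in> ?U - ?U \<inter> {m0..K}"
      then have "\<not> k \<le> K" using \<open>?U \<subseteq> {m0..}\<close> by fastforce
      then show "y k = 0" by (simp add: y)
    qed simp
    also have "\<dots> \<le> rad_norm {m0..K} y"
      by (rule rad_norm_mono) auto
    finally have "rad_norm {m0..n} (\<lambda>m. \<Sum>k\<in>B j m. (real m * a m k) *\<^sub>R y k)
        \<le> 2 * sqrt N * W * rad_norm {m0..K} y"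
      using D by (simp add: W_def mult_left_mono)
    then show "rad_norm {m0..n} (\<lambda>m. (1 / real L) *\<^sub>R (\<Sum>k\<in>B j m. (real m * a m k) *\<^sub>R y k))
        \<le> (1 / real L) * (2 * sqrt N * W * rad_norm {m0..K} y)"
      by (simp only: rad_norm_scaleR) (simp add: divide_right_mono)
  qed auto
  also have "\<dots> = 2 * (sqrt N * W) * rad_norm {m0..K} y"
    using L by simp
  also have "sqrt N * W = D * real N powr - b"
    using N by (simp add: W_def powr_half_sqrt[symmetric] flip: powr_add)
  finally show ?thesis by simp
qed

text \<open>The dyadic ranges of \<open>k / m\<close> contribute a geometric series of ratio
  \<open>2 powr - b\<close>, whose sum is the source of the constant.\<close>

lemma rad_norm_hardy:
  assumes b: "b > 0" and D: "D \<ge> 0" and m0: "m0 > 0"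
    and a: "\<And>m k. 0 < m \<Longrightarrow> m \<le> k \<Longrightarrow> \<bar>a m k\<bar> \<le> D * real m powr (b - 1/2) * real k powr (- b - 1/2)"
  shows "rad_norm {m0..n} (\<lambda>m. \<Sum>k=m..K. a m k *\<^sub>R y k)
      \<le> 2 * D / (1 - 2 powr - b) * rad_norm {m0..K} y"
proof -
  \<comment> \<open>A dyadic range may reach beyond \<open>K\<close>; the truncation makes the
    excess vanish. \<open>K\<close> ranges cover \<open>{m..K}\<close> because
    \<open>K < 2 ^ K\<close>.\<close>
  define z where "z k = (if k \<le> K then y k else 0)" for k
  have "rad_norm {m0..n} (\<lambda>m. \<Sum>k=m..K. a m k *\<^sub>R y k)
      = rad_norm {m0..n} (\<lambda>m. \<Sum>r<K. \<Sum>k\<in>{2 ^ r * m..<2 * 2 ^ r * m}. a m k *\<^sub>R z k)"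
  proof (rule rad_norm_cong)
    fix m assume "m \<in> {m0..n}"
    then have m: "m > 0" using m0 by auto
    have "K < 2 ^ K" by (rule less_exp)
    also have "2 ^ K * 1 \<le> 2 ^ K * m" using m by (intro mult_le_mono2) simp
    finally have K: "K < 2 ^ K * m" by simp
    have "(\<Sum>k=m..K. a m k *\<^sub>R y k) = (\<Sum>k\<in>{m..<2 ^ K * m}. a m k *\<^sub>R z k)"
      using K by (intro sum.mono_neutral_cong_left) (auto simp: z_def)
    also have "\<dots> = (\<Sum>r<K. \<Sum>k\<in>{2 ^ r * m..<2 * 2 ^ r * m}. a m k *\<^sub>R z k)"
      using sum_consecutive_blocks[of "\<lambda>r. 2 ^ r * m" "\<lambda>k. a m k *\<^sub>R z k" K]
      by (simp add: mono_def power_increasing)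
    finally show "(\<Sum>k=m..K. a m k *\<^sub>R y k)
      = (\<Sum>r<K. \<Sum>k\<in>{2 ^ r * m..<2 * 2 ^ r * m}. a m k *\<^sub>R z k)" .
  qed
  also have "\<dots> \<le> (\<Sum>r<K. 2 * D * real (2 ^ r) powr - b * rad_norm {m0..K} z)"
    by (intro order.trans[OF rad_norm_sum] sum_mono rad_norm_dyadic_piece)
      (use assms in \<open>auto simp: z_def\<close>)
  also have "\<dots> = 2 * D * rad_norm {m0..K} z * (\<Sum>r<K. (2 powr - b) ^ r)"
    by (simp add: sum_distrib_left powr_power mult_ac flip: powr_realpow) (simp add: powr_powr mult.commute)
  also have "\<dots> \<le> 2 * D * rad_norm {m0..K} z * (1 / (1 - 2 powr - b))"
  proof (intro mult_left_mono)
    have lt: "2 powr - b < (1::real)" using b by (simp add: powr_less_one)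
    then show "(\<Sum>r<K. (2 powr - b) ^ r) \<le> 1 / (1 - 2 powr - b)"
      using sum_le_suminf[of "\<lambda>r. (2 powr - b) ^ r" "{..<K}"]
      by (simp add: summable_geometric suminf_geometric)
  qed (use D in auto)
  also have "rad_norm {m0..K} z = rad_norm {m0..K} y"
    by (rule rad_norm_cong) (simp add: z_def)
  finally show ?thesis by (simp add: mult_ac)
qed

section \<open>Binomial series of a power bounded operator\<close>

text \<open>The Taylor coefficients of \<open>(1 - z)^(-a)\<close>. With this sign they are
  nonnegative for a \<ge> 0, and Cauchy products add the parameters.\<close>

definition binc :: "real \<Rightarrow> nat \<Rightarrow> real" where
  "binc a k = pochhammer a k / fact k"

lemma binc_0 [simp]: "binc a 0 = 1"
  by (simp add: binc_def)

lemma binc_Suc: "binc a (Suc k) = binc a k * (a + real k) / real (Suc k)"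
  by (simp add: binc_def pochhammer_rec' mult.commute)

lemma binc_1 [simp]: "binc 1 k = 1"
  by (simp add: binc_def flip: pochhammer_fact)

lemma binc_zero [simp]: "binc 0 (Suc k) = 0"
  by (induction k) (simp_all add: binc_Suc)

lemma binc_nonneg: "a \<ge> 0 \<Longrightarrow> binc a k \<ge> 0"
  by (induction k) (simp_all add: binc_Suc)

lemma binc_vandermonde: "(\<Sum>i\<le>k. binc a i * binc b (k - i)) = binc (a + b) k"
proof -
  have "binc (a + b) k = (\<Sum>i\<le>k. (of_nat (k choose i) * pochhammer a i * pochhammer b (k - i)) / fact k)"
    by (simp add: binc_def pochhammer_binomial_sum sum_divide_distrib)
  also have "\<dots> = (\<Sum>i\<le>k. binc a i * binc b (k - i))"
    by (intro sum.cong) (simp_all add: binc_def binomial_fact)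
  finally show ?thesis ..
qed

text \<open>Taking partial sums multiplies the generating function by
  \<open>1 / (1 - z)\<close>.\<close>

lemma sum_binc: "(\<Sum>i\<le>k. binc a i) = binc (a + 1) k"
  using binc_vandermonde[of a 1 k] by simp

text \<open>Successive coefficients have ratio \<open>1 + (a - 1) / (k + 1)\<close>, at most the
  exponential of \<open>(a - 1) / (k + 1)\<close>. The sign of \<open>a - 1\<close> decides whether
  a lower or an upper bound for the harmonic numbers turns this into a power of
  \<open>k\<close>.\<close>

lemma binc_le_exp_harm:
  assumes "a \<ge> 0"
  shows "binc a k \<le> exp ((a - 1) * harm k)"
proof (induction k)
  case 0
  then show ?case by (simp add: harm_def)
next
  case (Suc k)
  have "binc a (Suc k) = binc a k * (1 + (a - 1) / real (Suc k))"
    by (simp add: binc_Suc field_simps)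
  also have "\<dots> \<le> exp ((a - 1) * harm k) * exp ((a - 1) / real (Suc k))"
    using Suc exp_ge_add_one_self[of "(a - 1) / real (Suc k)"] assms
    by (intro mult_mono) (auto simp: field_simps)
  also have "\<dots> = exp ((a - 1) * harm (Suc k))"
    by (simp add: harm_Suc divide_inverse ring_distribs flip: exp_add)
  finally show ?case .
qed

lemma binc_le_powr_small:
  assumes "0 \<le> a" "a \<le> 1"
  shows "binc a k \<le> real (Suc k) powr (a - 1)"
proof -
  have "(a - 1) * harm k \<le> (a - 1) * ln (real k + 1)"
    using assms ln_le_harm[of k] by (intro mult_left_mono_neg) auto
  then show ?thesis
    using order.trans[OF binc_le_exp_harm[OF assms(1)]] by (simp add: powr_def add.commute)
qed

lemma binc_le_powr_large:
  assumes "1 \<le> a"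
  shows "binc a k \<le> exp (a - 1) * real (Suc k) powr (a - 1)"
proof -
  have "harm k \<le> 1 + ln (real (Suc k))"
  proof (cases k)
    case (Suc n)
    \<comment> \<open>\<open>harm k - ln k\<close> decreases from its value 1 at
      \<open>k = 1\<close>; the factor \<open>exp (a - 1)\<close> comes from this 1.\<close>
    have "harm k - ln (real k) \<le> harm (Suc 0) - ln (real (Suc 0))"
      using decseqD[OF decseq_harm_diff_ln, of 0 n] Suc by (simp only: le0)
    moreover have "harm (Suc 0) = (1::real)" by (simp add: harm_def)
    moreover have "ln (real k) \<le> ln (real (Suc k))" using Suc by simp
    ultimately show ?thesis by simp
  qed (simp add: harm_def)
  then have "(a - 1) * harm k \<le> (a - 1) * (1 + ln (real (Suc k)))"
    using assms by (intro mult_left_mono) auto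
  then have "exp ((a - 1) * harm k) \<le> exp (a - 1) * real (Suc k) powr (a - 1)"
    by (simp add: powr_def ring_distribs flip: exp_add)
  then show ?thesis
    using binc_le_exp_harm[of a k] assms by linarith
qed

lemma binc_tendsto_0:
  assumes "0 \<le> a" "a < 1"
  shows "binc a \<longlonglongrightarrow> 0"
proof (rule tendsto_sandwich[where f = "\<lambda>_. 0"])
  show "(\<lambda>k. real (Suc k) powr (a - 1)) \<longlonglongrightarrow> 0"
    using assms by (intro tendsto_neg_powr filterlim_compose[OF filterlim_real_sequentially filterlim_Suc]) auto
  show "\<forall>\<^sub>F k in sequentially. 0 \<le> binc a k"
    using assms by (simp add: binc_nonneg)
  show "\<forall>\<^sub>F k in sequentially. binc a k \<le> real (Suc k) powr (a - 1)"
    using assms by (intro always_eventually allI binc_le_powr_small) auto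
qed simp

definition binc_summable :: "real \<Rightarrow> bool" where
  "binc_summable a \<longleftrightarrow> summable (\<lambda>k. \<bar>binc (- a) k\<bar>)"

text \<open>For these exponents all coefficients of \<open>(1 - z)^a\<close> after the first are at
  most 0. The sum of absolute values is therefore 2 minus the signed partial sum, and the latter is
  \<open>binc (1 - a) n\<close>, which is nonnegative.\<close>

lemma binc_summable_small:
  assumes "0 \<le> a" "a \<le> 1"
  shows "binc_summable a"
  unfolding binc_summable_def
proof (rule summableI_nonneg_bounded)
  have neg: "binc (- a) k \<le> 0" if "k > 0" for k
    using that
  proof (induction k)
    case (Suc k)
    then show ?case
      using assms by (cases "k = 0") (auto simp: binc_Suc divide_nonpos_pos mult_nonpos_nonneg)
  qed simp
  fix n
  have "(\<Sum>k<n. \<bar>binc (- a) k\<bar>) \<le> (\<Sum>k\<le>n. \<bar>binc (- a) k\<bar>)"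
    by (intro sum_mono2) auto
  also have "\<dots> = (\<Sum>k\<le>n. (if k = 0 then 2 else 0) - binc (- a) k)"
    using neg by (intro sum.cong) (auto simp: abs_of_nonpos)
  also have "\<dots> = 2 - binc (1 - a) n"
    by (simp add: sum_subtractf sum_binc)
  also have "\<dots> \<le> 2" using assms by (simp add: binc_nonneg)
  finally show "(\<Sum>k<n. \<bar>binc (- a) k\<bar>) \<le> 2" .
qed simp

lemma binc_summable_add:
  assumes "binc_summable a" "binc_summable b"
  shows "binc_summable (a + b)"
proof -
  have "summable (\<lambda>k. \<Sum>i\<le>k. \<bar>binc (- a) i\<bar> * \<bar>binc (- b) (k - i)\<bar>)"
    using assms unfolding binc_summable_def by (intro summable_Cauchy_product) auto
  then show ?thesis
    unfolding binc_summable_def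
  proof (rule summable_comparison_test')
    fix k :: nat
    have "\<bar>binc (- (a + b)) k\<bar> = \<bar>\<Sum>i\<le>k. binc (- a) i * binc (- b) (k - i)\<bar>"
      by (simp add: binc_vandermonde)
    also have "\<dots> \<le> (\<Sum>i\<le>k. \<bar>binc (- a) i\<bar> * \<bar>binc (- b) (k - i)\<bar>)"
      by (intro order.trans[OF sum_abs]) (simp add: abs_mult)
    finally show "norm \<bar>binc (- (a + b)) k\<bar> \<le> (\<Sum>i\<le>k. \<bar>binc (- a) i\<bar> * \<bar>binc (- b) (k - i)\<bar>)"
      by simp
  qed
qed

text \<open>Above exponent 1 the sign argument fails; Cauchy products of factors with exponents in
  \<open>[0, 1]\<close> take its place.\<close>

lemma binc_summable_nonneg:
  assumes "a \<ge> 0"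
  shows "binc_summable a"
proof -
  have nat: "binc_summable (real n)" for n
  proof (induction n)
    case (Suc n)
    then show ?case
      using binc_summable_add[OF binc_summable_small[of 1] Suc] by simp
  qed (simp add: binc_summable_small)
  have "binc_summable (real (nat \<lfloor>a\<rfloor>) + frac a)"
    using frac_lt_1[of a] by (intro binc_summable_add nat binc_summable_small) auto
  then show ?thesis using assms by (simp add: frac_def)
qed

text \<open>Both differences are sums over the part of the square where i + j \<ge> n, so the terms
  can be compared one by one. This reduces the Cauchy product of operator series to that of the
  absolute values of the coefficients.\<close>

lemma norm_square_minus_triangle:
  fixes f :: "nat \<Rightarrow> nat \<Rightarrow> 'a::real_normed_vector"
  assumes "\<And>i j. norm (f i j) \<le> g i j"
  shows "norm ((\<Sum>i<n. \<Sum>j<n. f i j) - (\<Sum>k<n. \<Sum>i\<le>k. f i (k - i)))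
      \<le> (\<Sum>i<n. \<Sum>j<n. g i j) - (\<Sum>k<n. \<Sum>i\<le>k. g i (k - i))"
proof -
  define S where "S = {..<n} \<times> {..<n}"
  define D where "D = {(i, j). i + j < n}"
  have D: "D \<subseteq> S" "finite S" by (auto simp: S_def D_def)
  have eq: "(\<Sum>i<n. \<Sum>j<n. h i j) - (\<Sum>k<n. \<Sum>i\<le>k. h i (k - i)) = (\<Sum>(i, j)\<in>S - D. h i j)"
    for h :: "nat \<Rightarrow> nat \<Rightarrow> 'b::real_vector"
    using D by (simp add: sum_diff S_def D_def sum.cartesian_product sum.triangle_reindex)
  have "norm (\<Sum>(i, j)\<in>S - D. f i j) \<le> (\<Sum>(i, j)\<in>S - D. g i j)"
    by (rule sum_norm_le) (use assms in auto)
  then show ?thesis by (simp only: eq)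
qed

section \<open>Fractional powers as binomial series: the semigroup law\<close>

definition fpow :: "('a::banach \<Rightarrow> 'a) \<Rightarrow> real \<Rightarrow> 'a \<Rightarrow> 'a" where
  "fpow T a x = (\<Sum>k. binc (- a) k *\<^sub>R (T ^^ k) x)"

locale power_bounded =
  fixes T :: "'a::banach \<Rightarrow> 'a" and C :: real
  assumes bounded_linear: "bounded_linear T"
    and norm_power_le: "norm ((T ^^ n) x) \<le> C * norm x"
begin

lemma linear_power: "bounded_linear (T ^^ n)"
proof (induction n)
  case (Suc n)
  then show ?case
    using bounded_linear_compose[OF bounded_linear] by (simp add: comp_def)
qed (simp add: id_def)

lemmas power_diff = linear_diff[OF bounded_linear.linear[OF linear_power]]
lemmas power_scaleR = linear_scale[OF bounded_linear.linear[OF linear_power]]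
lemmas power_sum = linear_sum[OF bounded_linear.linear[OF linear_power]]

lemma funpow_add_apply: "(T ^^ (m + n)) x = (T ^^ m) ((T ^^ n) x)"
  by (simp add: funpow_add)

text \<open>The norm is part of the statement because \<open>C\<close> itself may be negative when
  the space is zero.\<close>

lemma C_nonneg: "0 \<le> C * norm (x :: 'a)"
  using norm_power_le[of 0 x] norm_ge_zero[of x] by (simp only: funpow_0)

lemma summable_fpow:
  assumes "a \<ge> 0"
  shows "summable (\<lambda>k. binc (- a) k *\<^sub>R (T ^^ k) x)"
proof (rule summable_comparison_test')
  show "summable (\<lambda>k. \<bar>binc (- a) k\<bar> * (C * norm x))"
    using binc_summable_nonneg[OF assms] unfolding binc_summable_def by (rule summable_mult2)
  show "norm (binc (- a) k *\<^sub>R (T ^^ k) x) \<le> \<bar>binc (- a) k\<bar> * (C * norm x)" for k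
    by (simp add: mult_left_mono norm_power_le)
qed

lemma fpow_sums: "a \<ge> 0 \<Longrightarrow> (\<lambda>k. binc (- a) k *\<^sub>R (T ^^ k) x) sums fpow T a x"
  unfolding fpow_def by (rule summable_sums[OF summable_fpow])

lemma fpow_0 [simp]: "fpow T 0 x = x"
proof -
  have "(\<lambda>k. binc (- 0) k *\<^sub>R (T ^^ k) x) sums (\<Sum>k\<in>{0}. binc (- 0) k *\<^sub>R (T ^^ k) x)"
    by (rule sums_finite) (auto simp: gr0_conv_Suc)
  then show ?thesis
    using fpow_sums[of 0 x] sums_unique2 by fastforce
qed

lemma fpow_1: "fpow T 1 x = x - T x"
proof -
  have binc_0: "binc (- 1) (Suc (Suc k)) = 0" for k
    by (induction k) (simp_all add: binc_Suc)
  have "binc (- 1) k = 0" if "k \<notin> {0, 1}" for k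
  proof -
    have "k \<noteq> 0" "k \<noteq> 1" using that by auto
    then have "k = Suc (Suc (k - 2))" by linarith
    then show ?thesis using binc_0 by metis
  qed
  then have "(\<lambda>k. binc (- 1) k *\<^sub>R (T ^^ k) x) sums (\<Sum>k\<in>{0, 1}. binc (- 1) k *\<^sub>R (T ^^ k) x)"
    by (intro sums_finite) simp_all
  then show ?thesis
    using fpow_sums[of 1 x] sums_unique2 by (fastforce simp: binc_Suc)
qed

text \<open>Two errors separate the iterated series from the Cauchy product. Replacing the inner
  limit by a partial sum costs at most \<open>A * C\<close> times the remainder of the inner series.
  Passing from square to triangular partial sums costs a quantity that vanishes by the Cauchy
  product of real series.\<close>

lemma fpow_add:
  assumes a: "a \<ge> 0" and b: "b \<ge> 0"
  shows "fpow T a (fpow T b x) = fpow T (a + b) x"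
proof -
  define U where "U n y = (\<Sum>i<n. binc (- a) i *\<^sub>R (T ^^ i) y)" for n y
  define V where "V n = (\<Sum>j<n. binc (- b) j *\<^sub>R (T ^^ j) x)" for n
  define W where "W n = (\<Sum>k<n. binc (- (a + b)) k *\<^sub>R (T ^^ k) x)" for n
  define A where "A = (\<Sum>k. \<bar>binc (- a) k\<bar>)"
  define f where "f i j = (binc (- a) i * binc (- b) j) *\<^sub>R (T ^^ (i + j)) x" for i j
  define g where "g i j = \<bar>binc (- a) i\<bar> * \<bar>binc (- b) j\<bar> * (C * norm x)" for i j
  have sa: "summable (\<lambda>k. \<bar>binc (- a) k\<bar>)" and sb: "summable (\<lambda>k. \<bar>binc (- b) k\<bar>)"
    using a b binc_summable_nonneg by (auto simp: binc_summable_def)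
  have V: "V \<longlonglongrightarrow> fpow T b x"
    using fpow_sums[OF b, of x] by (simp add: sums_def V_def[abs_def])
  have "(\<lambda>n. U n (fpow T b x)) \<longlonglongrightarrow> fpow T a (fpow T b x)"
    using fpow_sums[OF a, of "fpow T b x"] by (simp add: sums_def U_def)
  moreover have "(\<lambda>n. U n (fpow T b x) - U n (V n)) \<longlonglongrightarrow> 0"
  proof (rule Lim_null_comparison)
    show "(\<lambda>n. A * (C * norm (fpow T b x - V n))) \<longlonglongrightarrow> 0"
      using tendsto_mult_right_zero[OF tendsto_mult_right_zero[OF tendsto_norm_zero[OF
            LIM_zero[OF V]]], of A C] by (simp add: norm_minus_commute)
    show "\<forall>\<^sub>F n in sequentially. norm (U n (fpow T b x) - U n (V n)) \<le> A * (C * norm (fpow T b x - V n))"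
    proof (rule always_eventually, rule allI)
      fix n
      have "norm (U n (fpow T b x) - U n (V n)) = norm (U n (fpow T b x - V n))"
        by (simp add: U_def power_diff sum_subtractf scaleR_diff_right)
      also have "\<dots> \<le> (\<Sum>i<n. \<bar>binc (- a) i\<bar> * (C * norm (fpow T b x - V n)))"
        unfolding U_def by (intro sum_norm_le) (simp add: mult_left_mono norm_power_le)
      also have "\<dots> \<le> A * (C * norm (fpow T b x - V n))"
        unfolding A_def sum_distrib_right[symmetric]
        using sa C_nonneg by (intro mult_right_mono sum_le_suminf) auto
      finally show "norm (U n (fpow T b x) - U n (V n)) \<le> A * (C * norm (fpow T b x - V n))" .
    qed
  qed
  moreover have "(\<lambda>n. U n (V n) - W n) \<longlonglongrightarrow> 0"
  proof (rule Lim_null_comparison)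
    have UV: "U n (V n) = (\<Sum>i<n. \<Sum>j<n. f i j)" for n
      by (simp add: U_def V_def f_def power_sum power_scaleR scaleR_sum_right funpow_add_apply)
    have W: "W n = (\<Sum>k<n. \<Sum>i\<le>k. f i (k - i))" for n
      using binc_vandermonde[of "- a" "- b"]
      by (simp add: W_def f_def scaleR_sum_left[symmetric])
    show "\<forall>\<^sub>F n in sequentially. norm (U n (V n) - W n)
        \<le> (\<Sum>i<n. \<Sum>j<n. g i j) - (\<Sum>k<n. \<Sum>i\<le>k. g i (k - i))"
      unfolding UV W
      by (intro always_eventually allI norm_square_minus_triangle)
        (simp add: f_def g_def abs_mult mult_left_mono norm_power_le)
    have "(\<lambda>n. ((\<Sum>i<n. \<bar>binc (- a) i\<bar>) * (\<Sum>j<n. \<bar>binc (- b) j\<bar>)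
          - (\<Sum>k<n. \<Sum>i\<le>k. \<bar>binc (- a) i\<bar> * \<bar>binc (- b) (k - i)\<bar>)) * (C * norm x))
        \<longlonglongrightarrow> (A * (\<Sum>k. \<bar>binc (- b) k\<bar>) - A * (\<Sum>k. \<bar>binc (- b) k\<bar>)) * (C * norm x)"
      unfolding A_def using sa sb
      by (intro tendsto_intros summable_LIMSEQ Cauchy_product_sums[unfolded sums_def]) auto
    then show "(\<lambda>n. (\<Sum>i<n. \<Sum>j<n. g i j) - (\<Sum>k<n. \<Sum>i\<le>k. g i (k - i))) \<longlonglongrightarrow> 0"
      by (simp add: g_def sum_product left_diff_distrib sum_distrib_right[symmetric])
  qed
  ultimately have "(\<lambda>n. U n (fpow T b x) - (U n (fpow T b x) - U n (V n)) - (U n (V n) - W n))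
      \<longlonglongrightarrow> fpow T a (fpow T b x) - 0 - 0"
    by (intro tendsto_diff)
  then have "W \<longlonglongrightarrow> fpow T a (fpow T b x)" by simp
  moreover have "W \<longlonglongrightarrow> fpow T (a + b) x"
    using fpow_sums[of "a + b" x] a b by (simp add: sums_def W_def[abs_def])
  ultimately show ?thesis by (rule LIMSEQ_unique)
qed

lemma power_minus_fpow: "((\<lambda>z. z - T z) ^^ n) (fpow T a x) = fpow T (real n + a) x" if "a \<ge> 0"
  using that
proof (induction n)
  case (Suc n)
  have "((\<lambda>z. z - T z) ^^ Suc n) (fpow T a x) = fpow T 1 (fpow T (real n + a) x)"
    using Suc by (simp add: fpow_1)
  also have "\<dots> = fpow T (real (Suc n) + a) x"
    using Suc.prems by (simp add: fpow_add add_ac)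
  finally show ?case .
qed simp

end

section \<open>Balakrishnan's integral\<close>

text \<open>On a division fine for both gauges the Riemann sums of \<open>f\<close> and
  \<open>F n\<close> differ by at most that of \<open>G n\<close>, hence by nearly
  \<open>J n\<close>. A single \<open>n\<close> with \<open>J n\<close> small and \<open>I n\<close>
  close to \<open>i\<close> settles a given \<open>e\<close>.\<close>

lemma has_integral_limit_cbox:
  fixes f :: "'n::euclidean_space \<Rightarrow> 'a::real_normed_vector"
  assumes approx: "\<And>n. (F n has_integral I n) (cbox a b)" "\<And>n. (G n has_integral J n) (cbox a b)"
    and le: "\<And>n x. x \<in> cbox a b \<Longrightarrow> norm (f x - F n x) \<le> G n x"
    and J: "J \<longlonglongrightarrow> 0" and I: "I \<longlonglongrightarrow> i"
  shows "(f has_integral i) (cbox a b)"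
  unfolding has_integral
proof (intro allI impI)
  fix e :: real assume "e > 0"
  then have e: "e / 4 > 0" by simp
  have ev: "\<forall>\<^sub>F n in sequentially. \<bar>J n\<bar> < e / 4 \<and> norm (I n - i) < e / 4"
    using tendstoD[OF J e] tendstoD[OF I e] by (auto simp: dist_norm intro: eventually_conj)
  obtain n where n: "\<bar>J n\<bar> < e / 4" "norm (I n - i) < e / 4"
    using eventually_happens'[OF sequentially_bot ev] by blast
  obtain g where g: "gauge g"
    "\<And>p. p tagged_division_of cbox a b \<Longrightarrow> g fine p \<Longrightarrow>
        norm ((\<Sum>(x, k)\<in>p. measure lborel k *\<^sub>R F n x) - I n) < e / 4"
    using approx(1)[of n] e unfolding has_integral by metis
  obtain h where h: "gauge h"
    "\<And>p. p tagged_division_of cbox a b \<Longrightarrow> h fine p \<Longrightarrow>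
        norm ((\<Sum>(x, k)\<in>p. measure lborel k *\<^sub>R G n x) - J n) < e / 4"
    using approx(2)[of n] e unfolding has_integral by metis
  show "\<exists>\<gamma>. gauge \<gamma> \<and> (\<forall>p. p tagged_division_of cbox a b \<and> \<gamma> fine p \<longrightarrow>
      norm ((\<Sum>(x, k)\<in>p. measure lborel k *\<^sub>R f x) - i) < e)"
  proof (intro exI[of _ "\<lambda>x. g x \<inter> h x"] conjI allI impI gauge_Int g(1) h(1), elim conjE)
    fix p assume p: "p tagged_division_of cbox a b" and fine: "(\<lambda>x. g x \<inter> h x) fine p"
    then have fine': "g fine p" "h fine p" by (auto simp: fine_Int)
    have "norm ((\<Sum>(x, k)\<in>p. measure lborel k *\<^sub>R f x) - (\<Sum>(x, k)\<in>p. measure lborel k *\<^sub>R F n x))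
        = norm (\<Sum>(x, k)\<in>p. measure lborel k *\<^sub>R (f x - F n x))"
      by (simp add: case_prod_unfold scaleR_diff_right sum_subtractf)
    also have "\<dots> \<le> (\<Sum>(x, k)\<in>p. measure lborel k *\<^sub>R G n x)"
    proof (rule sum_norm_le)
      fix z assume z: "z \<in> p"
      then have "fst z \<in> cbox a b"
        using p tag_in_interval[of p "cbox a b" "fst z" "snd z"] by simp
      then show "norm (case z of (x, k) \<Rightarrow> measure lborel k *\<^sub>R (f x - F n x)) \<le> (case z of (x, k) \<Rightarrow> measure lborel k *\<^sub>R G n x)"
        by (simp add: case_prod_unfold mult_left_mono le)
    qed
    also have "\<dots> < e / 4 + e / 4"
      using h(2)[OF p fine'(2)] n(1) unfolding real_norm_def by linarith
    finally have "norm ((\<Sum>(x, k)\<in>p. measure lborel k *\<^sub>R f x) - (\<Sum>(x, k)\<in>p. measure lborel k *\<^sub>R F n x)) < e / 4 + e / 4" .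
    moreover have "norm ((\<Sum>(x, k)\<in>p. measure lborel k *\<^sub>R F n x) - i) < e / 4 + e / 4"
      using g(2)[OF p fine'(1)] n(2) norm_diff_triangle_less by blast
    ultimately have "norm ((\<Sum>(x, k)\<in>p. measure lborel k *\<^sub>R f x) - i) < (e / 4 + e / 4) + (e / 4 + e / 4)"
      by (rule norm_diff_triangle_less)
    then show "norm ((\<Sum>(x, k)\<in>p. measure lborel k *\<^sub>R f x) - i) < e" by simp
  qed
qed

text \<open>A substitute for dominated convergence, which the library has for Henstock-Kurzweil
  integrals of Euclidean-valued functions only.\<close>
lemma has_integral_limit:
  fixes f :: "'n::euclidean_space \<Rightarrow> 'a::banach"
  assumes F: "\<And>n. (F n has_integral I n) S" and G: "\<And>n. (G n has_integral J n) S"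
    and le: "\<And>n x. x \<in> S \<Longrightarrow> norm (f x - F n x) \<le> G n x"
    and J: "J \<longlonglongrightarrow> 0" and I: "I \<longlonglongrightarrow> i"
  shows "(f has_integral i) S"
proof -
  define r where "r h x = (if x \<in> S then h x else 0)" for h :: "'n \<Rightarrow> 'a" and x
  define r' where "r' h x = (if x \<in> S then h x else 0)" for h :: "'n \<Rightarrow> real" and x
  have Fi: "r (F n) integrable_on cbox a b" for n a b
    using F[of n] unfolding has_integral_alt' by (simp add: r_def[abs_def])
  have Gi: "r' (G n) integrable_on cbox a b" for n a b
    using G[of n] unfolding has_integral_alt' by (simp add: r'_def[abs_def])
  have le': "norm (r f x - r (F n) x) \<le> r' (G n) x" for n x
    using le by (simp add: r_def r'_def)
  have G_nonneg: "0 \<le> r' (G n) x" for n x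
    using le'[of x n] norm_ge_zero order.trans by blast
  have GJ: "integral (cbox a b) (r' (G n)) \<le> J n" for a b n
  proof -
    have "(r' (G n) has_integral J n) UNIV"
      using G[of n] unfolding r'_def[abs_def] by (simp add: has_integral_restrict_UNIV)
    then show ?thesis
      using integral_subset_le[of "cbox a b" UNIV "r' (G n)"] Gi G_nonneg
      by (metis has_integral_integrable integral_unique subset_UNIV)
  qed
  \<comment> \<open>The integrals of \<open>F m\<close> and \<open>F n\<close> over a box are within
    \<open>J m + J n\<close> of each other, hence Cauchy. The resulting error \<open>J n\<close> is
    the same for every box, which later allows the boxes to exhaust the space.\<close>
  have cbox: "\<exists>z. (r f has_integral z) (cbox a b)
      \<and> (\<forall>n. norm (z - integral (cbox a b) (r (F n))) \<le> J n)" for a b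
  proof -
    define w where "w n = integral (cbox a b) (r (F n))" for n
    have "norm (w m - w n) \<le> J m + J n" for m n
    proof -
      have "norm (w m - w n) = norm (integral (cbox a b) (\<lambda>x. r (F m) x - r (F n) x))"
        using Fi by (simp add: w_def integral_diff)
      also have "\<dots> \<le> integral (cbox a b) (\<lambda>x. r' (G m) x + r' (G n) x)"
      proof (rule integral_norm_bound_integral)
        show "norm (r (F m) x - r (F n) x) \<le> r' (G m) x + r' (G n) x" for x
          using norm_triangle_le_diff[of "r f x - r (F n) x" "r f x - r (F m) x"] le'[of x m] le'[of x n]
          by simp
      qed (use Fi Gi in \<open>auto intro: integrable_diff integrable_add\<close>)
      also have "\<dots> = integral (cbox a b) (r' (G m)) + integral (cbox a b) (r' (G n))"
        using Gi by (simp add: integral_add)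
      also have "\<dots> \<le> J m + J n" by (intro add_mono GJ)
      finally show ?thesis .
    qed
    note w = this
    have "Cauchy w"
    proof (rule CauchyI)
      fix e :: real assume "e > 0"
      then obtain N where N: "\<And>n. n \<ge> N \<Longrightarrow> \<bar>J n\<bar> < e / 2"
        using LIMSEQ_D[OF J, of "e / 2"] by auto
      have "norm (w m - w n) < e" if "m \<ge> N" "n \<ge> N" for m n
        using w[of m n] N[OF that(1)] N[OF that(2)] by linarith
      then show "\<exists>N. \<forall>m\<ge>N. \<forall>n\<ge>N. norm (w m - w n) < e" by blast
    qed
    then obtain z where z: "w \<longlonglongrightarrow> z"
      using Cauchy_convergent convergent_def by blast
    have "(\<lambda>n. integral (cbox a b) (r' (G n))) \<longlonglongrightarrow> 0"
      using GJ J G_nonneg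
      by (intro tendsto_sandwich[OF _ _ tendsto_const J] always_eventually allI integral_nonneg Gi) auto
    then have zf: "(r f has_integral z) (cbox a b)"
    proof (rule has_integral_limit_cbox[rotated 3])
      show "(r (F n) has_integral w n) (cbox a b)" for n
        unfolding w_def by (rule integrable_integral[OF Fi])
      show "(r' (G n) has_integral integral (cbox a b) (r' (G n))) (cbox a b)" for n
        by (rule integrable_integral[OF Gi])
    qed (rule le' z)+
    have "norm (z - w n) \<le> J n" for n
    proof -
      have "norm (z - w n) = norm (integral (cbox a b) (\<lambda>x. r f x - r (F n) x))"
        using Fi zf by (simp add: w_def integral_diff has_integral_integrable integral_unique)
      also have "\<dots> \<le> integral (cbox a b) (r' (G n))"
        using Fi Gi zf le' by (intro integral_norm_bound_integral integrable_diff) auto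
      also have "\<dots> \<le> J n" by (rule GJ)
      finally show ?thesis .
    qed
    then show ?thesis using zf unfolding w_def by blast
  qed
  show ?thesis
    unfolding has_integral_alt' r_def[symmetric, abs_def]
  proof (intro conjI allI impI)
    show "r f integrable_on cbox a b" for a b
      using cbox[of a b] by blast
    fix e :: real assume "e > 0"
    then have e: "e / 3 > 0" by simp
    have ev: "\<forall>\<^sub>F n in sequentially. \<bar>J n\<bar> < e / 3 \<and> norm (I n - i) < e / 3"
      using tendstoD[OF J e] tendstoD[OF I e] by (auto simp: dist_norm intro: eventually_conj)
    obtain n where n: "\<bar>J n\<bar> < e / 3" "norm (I n - i) < e / 3"
      using eventually_happens'[OF sequentially_bot ev] by blast
    obtain B where "B > 0"
      and B: "\<And>a b. ball 0 B \<subseteq> cbox a b \<Longrightarrow> norm (integral (cbox a b) (r (F n)) - I n) < e / 3"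
      using F[of n] e unfolding has_integral_alt' r_def[symmetric, abs_def] by blast
    have "norm (integral (cbox a b) (r f) - i) < e" if "ball 0 B \<subseteq> cbox a b" for a b
    proof -
      obtain z where z: "(r f has_integral z) (cbox a b)"
        "norm (z - integral (cbox a b) (r (F n))) \<le> J n"
        using cbox[of a b] by blast
      have "norm (z - integral (cbox a b) (r (F n))) < e / 3" using z(2) n(1) by simp
      from norm_diff_triangle_less[OF norm_diff_triangle_less[OF this B[OF that]] n(2)]
      show ?thesis using z(1) by (simp add: integral_unique)
    qed
    then show "\<exists>B>0. \<forall>a b. ball 0 B \<subseteq> cbox a b \<longrightarrow> norm (integral (cbox a b) (r f) - i) < e"
      using \<open>B > 0\<close> by blast
  qed
qed

section \<open>Beta integrals and binomial coefficients\<close>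

lemma has_integral_Beta_Ioi:
  fixes a b :: real
  assumes "a > 0" "b > 0"
  shows "((\<lambda>t. t powr (a - 1) * (1 + t) powr (- a - b)) has_integral Beta a b) {0<..}"
proof -
  \<comment> \<open>The substitution \<open>t = u / (1 - u)\<close> carries the Beta integral over
    \<open>(0, 1)\<close> to the half-line. Nonnegativity of the integrand supplies the absolute
    integrability that the change of variables requires.\<close>
  define g :: "real \<Rightarrow> real" where "g u = u / (1 - u)" for u
  define f :: "real \<Rightarrow> real" where "f t = t powr (a - 1) * (1 + t) powr (- a - b)" for t
  have img: "g ` {0<..<1} = {0<..}"
  proof (intro equalityI subsetI)
    fix t :: real assume "t \<in> {0<..}"
    then show "t \<in> g ` {0<..<1}"
      by (intro image_eqI[of _ _ "t / (1 + t)"]) (auto simp: g_def field_simps)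
  qed (auto simp: g_def)
  have eq: "\<bar>1 / (1 - u)\<^sup>2\<bar> * f (g u) = u powr (a - 1) * (1 - u) powr (b - 1)" if "u \<in> {0<..<1}" for u
  proof -
    have u: "0 < u" "0 < 1 - u" using that by auto
    have "1 + g u = (1 - u) powr (- 1)"
      using u by (simp add: g_def powr_minus field_simps)
    moreover have "g u = u * (1 - u) powr (- 1)"
      using u by (simp add: g_def powr_minus divide_inverse)
    moreover have "\<bar>1 / (1 - u)\<^sup>2\<bar> = (1 - u) powr (- 2)"
      using u by (simp add: powr_minus powr_numeral divide_inverse)
    ultimately have "\<bar>1 / (1 - u)\<^sup>2\<bar> * f (g u) = (1 - u) powr (- 2) * ((u * (1 - u) powr (- 1)) powr (a - 1)
        * ((1 - u) powr (- 1)) powr (- a - b))"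
      by (simp only: f_def)
    also have "(u * (1 - u) powr (- 1)) powr (a - 1) = u powr (a - 1) * (1 - u) powr (- (a - 1))"
      using u by (simp only: powr_mult powr_powr mult_minus_left mult_1)
    also have "((1 - u) powr (- 1)) powr (- a - b) = (1 - u) powr (a + b)"
      by (simp only: powr_powr) (simp add: add.commute)
    also have "(1 - u) powr (- 2) * (u powr (a - 1) * (1 - u) powr (- (a - 1)) * (1 - u) powr (a + b))
        = u powr (a - 1) * ((1 - u) powr (- 2) * ((1 - u) powr (- (a - 1)) * (1 - u) powr (a + b)))"
      by (simp only: mult_ac)
    also have "(1 - u) powr (- 2) * ((1 - u) powr (- (a - 1)) * (1 - u) powr (a + b)) = (1 - u) powr (b - 1)"
      by (simp flip: powr_add)
    finally show ?thesis .
  qed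
  have "((\<lambda>u. \<bar>1 / (1 - u)\<^sup>2\<bar> * f (g u)) has_integral Beta a b) {0<..<1}"
    using has_integral_Beta_real[OF assms] eq
    by (subst has_integral_cong[OF eq]) (simp_all add: has_integral_Icc_iff_Ioo)
  moreover from this have "(\<lambda>u. \<bar>1 / (1 - u)\<^sup>2\<bar> * f (g u)) absolutely_integrable_on {0<..<1}"
    by (intro nonnegative_absolutely_integrable_1) (auto simp: f_def)
  ultimately have "f absolutely_integrable_on g ` {0<..<1} \<and> integral (g ` {0<..<1}) f = Beta a b"
  proof (subst has_absolute_integral_change_of_variables_1'[symmetric])
    show "(g has_field_derivative 1 / (1 - u)\<^sup>2) (at u within {0<..<1})" if "u \<in> {0<..<1}" for u
      unfolding g_def[abs_def] using that
      by (auto intro!: derivative_eq_intros simp: power2_eq_square field_simps)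
    show "inj_on g {0<..<1}"
      by (auto simp: inj_on_def g_def field_simps)
  qed (auto simp: integral_unique)
  then have "f integrable_on {0<..}" "integral {0<..} f = Beta a b"
    unfolding img by (auto intro: set_lebesgue_integral_eq_integral(1))
  then have "(f has_integral Beta a b) {0<..}"
    using integrable_integral[of f "{0<..}"] by simp
  then show ?thesis by (simp add: f_def[abs_def])
qed

lemma Gamma_reflection_real: "Gamma x * Gamma (1 - x) = pi / sin (pi * (x::real))"
proof -
  have "complex_of_real (Gamma x * Gamma (1 - x)) = Gamma (of_real x) * Gamma (1 - of_real x)"
    using Gamma_complex_of_real[of x] Gamma_complex_of_real[of "1 - x"] by simp
  also have "\<dots> = of_real (pi / sin (pi * x))"
    by (simp add: Gamma_reflection_complex sin_of_real flip: of_real_mult)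
  finally show ?thesis by (simp only: of_real_eq_iff)
qed

text \<open>This Beta value is the integral of
  \<open>t powr (a - 1) * (1 + t) powr - (k + 1)\<close>. By the reflection formula Balakrishnan's
  factor \<open>sin (pi a) / pi\<close> cancels \<open>Gamma a * Gamma (1 - a)\<close>, and a
  binomial coefficient remains.\<close>

lemma binc_eq_Beta:
  assumes "0 < a" "a < 1"
  shows "sin (pi * a) / pi * Beta a (real (Suc k) - a) = binc (1 - a) k"
proof -
  have "1 - a \<notin> \<int>\<^sub>\<le>\<^sub>0"
  proof
    assume "1 - a \<in> \<int>\<^sub>\<le>\<^sub>0"
    then have "1 - a \<le> 0" by (auto elim!: nonpos_Ints_cases)
    with assms show False by simp
  qed
  moreover from this have "Gamma (1 - a) \<noteq> 0"
    by (simp add: Gamma_eq_zero_iff)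
  ultimately have "Gamma (1 - a + real k) = pochhammer (1 - a) k * Gamma (1 - a)"
    by (simp add: pochhammer_Gamma)
  moreover have "real (Suc k) - a = 1 - a + real k" "a + (1 - a + real k) = 1 + real k" by simp_all
  ultimately have "Beta a (real (Suc k) - a) = Gamma a * (pochhammer (1 - a) k * Gamma (1 - a)) / Gamma (1 + real k)"
    by (simp only: Beta_def)
  then have "Beta a (real (Suc k) - a) = (Gamma a * Gamma (1 - a)) * binc (1 - a) k"
    by (simp add: binc_def Gamma_fact)
  then show ?thesis
    using assms sin_gt_zero[of "pi * a"] by (simp add: Gamma_reflection_real)
qed

section \<open>Resolvent expansion and Balakrishnan's formula\<close>

context power_bounded
begin

text \<open>The Neumann series of \<open>((1 + t) I - T)^(-1)\<close>. Injectivity gets its own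
  argument because \<open>inv\<close> merely selects some preimage, which has to be identified with
  the sum of the series.\<close>

lemma
  fixes x :: 'a and t :: real
  assumes "t > 0"
  defines "r \<equiv> inv (\<lambda>y. t *\<^sub>R y + (y - T y)) x"
  shows resolvent_sums: "(\<lambda>k. (1 / (1 + t)) ^ Suc k *\<^sub>R (T ^^ k) x) sums r"
    and resolvent_eq: "t *\<^sub>R r + (r - T r) = x"
proof -
  define q where "q = 1 / (1 + t)"
  define f where "f y = t *\<^sub>R y + (y - T y)" for y
  have q: "0 < q" "q < 1" "(1 + t) * q = 1" using assms by (auto simp: q_def)
  have "summable (\<lambda>k. q ^ Suc k *\<^sub>R (T ^^ k) x)"
  proof (rule summable_comparison_test')
    show "summable (\<lambda>k. q ^ Suc k * (C * norm x))"
      using q by (intro summable_mult2) (simp add: summable_geometric)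
    show "norm (q ^ Suc k *\<^sub>R (T ^^ k) x) \<le> q ^ Suc k * (C * norm x)" for k
      using q by (simp add: mult_left_mono norm_power_le)
  qed
  then obtain R where R: "(\<lambda>k. q ^ Suc k *\<^sub>R (T ^^ k) x) sums R"
    using summable_sums by blast
  have "(\<lambda>k. T (q ^ Suc k *\<^sub>R (T ^^ k) x)) sums T R"
    by (rule bounded_linear.sums[OF bounded_linear R])
  then have "(\<lambda>k. (1 + t) *\<^sub>R q ^ Suc (Suc k) *\<^sub>R (T ^^ Suc k) x) sums T R"
    using q(3) by (simp add: linear_scale[OF bounded_linear.linear[OF bounded_linear]] mult.assoc[symmetric])
  moreover have "(\<lambda>k. (1 + t) *\<^sub>R q ^ Suc (Suc k) *\<^sub>R (T ^^ Suc k) x) sums ((1 + t) *\<^sub>R (R - q *\<^sub>R x))"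
    using R by (intro sums_scaleR_right) (subst sums_Suc_iff, simp)
  ultimately have "T R = (1 + t) *\<^sub>R (R - q *\<^sub>R x)"
    by (rule sums_unique2)
  then have fR: "f R = x"
    using q(3) by (simp add: f_def scaleR_diff_right scaleR_add_left)
  \<comment> \<open>A nonzero \<open>w\<close> in the kernel would satisfy
    \<open>T w = (1 + t) w\<close>, and its orbit would outgrow the power bound.\<close>
  have "inj f"
  proof (rule injI)
    fix y z assume "f y = f z"
    define w where "w = y - z"
    have "T w = (1 + t) *\<^sub>R w"
      using \<open>f y = f z\<close>
      by (simp add: w_def f_def linear_diff[OF bounded_linear.linear[OF bounded_linear]] algebra_simps)
    then have Tw: "(T ^^ n) w = (1 + t) ^ n *\<^sub>R w" for n
      by (induction n) (simp_all add: linear_scale[OF bounded_linear.linear[OF bounded_linear]] mult.commute)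
    obtain n where n: "C < (1 + t) ^ n"
      using real_arch_pow[of "1 + t" C] assms by auto
    have "(1 + t) ^ n * norm w \<le> C * norm w"
      using norm_power_le[of n w] assms by (simp add: Tw)
    then have "w = 0"
      using n by (metis mult_le_cancel_right_pos not_le zero_less_norm_iff)
    then show "y = z" by (simp add: w_def)
  qed
  then have "inv f x = R" using fR by (rule inv_f_eq)
  then have r: "r = R" by (simp add: f_def[abs_def] r_def)
  show "(\<lambda>k. (1 / (1 + t)) ^ Suc k *\<^sub>R (T ^^ k) x) sums r"
    using R by (simp add: r q_def)
  show "t *\<^sub>R r + (r - T r) = x"
    using fR by (simp add: r f_def)
qed

text \<open>Since \<open>t powr (a - 1)\<close> is not integrable at infinity,
  \<open>A R = x - t R\<close> cannot be integrated term by term as it stands. With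
  \<open>q = 1 / (1 + t)\<close> the identity \<open>t q = 1 - q\<close> merges \<open>x\<close>
  with the leading term of the series and turns the other coefficients into differences of the
  integrable functions \<open>h k\<close>, k \<ge> 1. The remainder is at most
  \<open>C * norm x * h (n + 1)\<close>, whose integral tends to 0.\<close>

lemma has_integral_balakrishnan:
  assumes a: "0 < a" "a < 1"
  shows "((\<lambda>t. t powr (a - 1) *\<^sub>R (inv (\<lambda>y. t *\<^sub>R y + (y - T y)) x - T (inv (\<lambda>y. t *\<^sub>R y + (y - T y)) x)))
      has_integral (pi / sin (pi * a)) *\<^sub>R fpow T a x) {0<..}"
proof -
  define h where "h k t = t powr (a - 1) * (1 / (1 + t)) ^ k" for k t
  define K where "K k = Beta a (real k - a)" for k
  define R where "R t = inv (\<lambda>y. t *\<^sub>R y + (y - T y)) x" for t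
  have sin: "sin (pi * a) > 0" using a by (intro sin_gt_zero) auto
  have h: "(h (Suc k) has_integral K (Suc k)) {0<..}" for k
  proof -
    have "((\<lambda>t. t powr (a - 1) * (1 + t) powr (- a - (real (Suc k) - a))) has_integral K (Suc k)) {0<..}"
      unfolding K_def using a by (intro has_integral_Beta_Ioi) auto
    then show ?thesis
    proof (rule has_integral_eq[rotated])
      fix t :: real assume "t \<in> {0<..}"
      moreover have "- a - (real (Suc k) - a) = - real (Suc k)" by simp
      ultimately have "(1 + t) powr (- a - (real (Suc k) - a)) = inverse ((1 + t) ^ Suc k)"
        by (simp only: powr_minus) (subst powr_realpow, auto)
      then show "t powr (a - 1) * (1 + t) powr (- a - (real (Suc k) - a)) = h (Suc k) t"
        by (simp only: h_def power_one_over inverse_eq_divide)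
    qed
  qed
  have K: "K (Suc k) = pi / sin (pi * a) * binc (1 - a) k" for k
    using binc_eq_Beta[OF a, of k] sin by (simp add: K_def field_simps)
  define F where "F n t = h 1 t *\<^sub>R x - (\<Sum>k<n. (h (Suc k) t - h (Suc (Suc k)) t) *\<^sub>R (T ^^ Suc k) x)" for n t
  define I where "I n = K 1 *\<^sub>R x - (\<Sum>k<n. (K (Suc k) - K (Suc (Suc k))) *\<^sub>R (T ^^ Suc k) x)" for n
  \<comment> \<open>Consecutive coefficients of \<open>(1 - z)^(a - 1)\<close> differ by a
    coefficient of \<open>(1 - z)^a\<close>, so integration produces the partial sums of
    \<open>fpow\<close>.\<close>
  have I: "I n = (pi / sin (pi * a)) *\<^sub>R (\<Sum>k<Suc n. binc (- a) k *\<^sub>R (T ^^ k) x)" for n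
  proof -
    have "K 1 = pi / sin (pi * a)" using K[of 0] by simp
    moreover have "K (Suc k) - K (Suc (Suc k)) = - (pi / sin (pi * a) * binc (- a) (Suc k))" for k
    proof -
      have "binc (1 - a) (Suc k) = binc (1 - a) k + binc (- a) (Suc k)"
        using sum_binc[of "- a" "Suc k"] sum_binc[of "- a" k] by simp
      then show ?thesis unfolding K by (simp add: distrib_left)
    qed
    ultimately show ?thesis
      by (simp only: I_def sum.lessThan_Suc_shift)
        (simp add: sum_negf scaleR_add_right scaleR_sum_right)
  qed
  have "((\<lambda>t. t powr (a - 1) *\<^sub>R (R t - T (R t))) has_integral (pi / sin (pi * a)) *\<^sub>R fpow T a x) {0<..}"
  proof (rule has_integral_limit)
    show "(F n has_integral I n) {0<..}" for n
      unfolding F_def[abs_def] I_def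
      using h[of 0] by (intro has_integral_diff has_integral_sum has_integral_scaleR_left h) auto
    show "((\<lambda>t. (C * norm x) * h (Suc n) t) has_integral (C * norm x) * K (Suc n)) {0<..}" for n
      by (intro has_integral_mult_right h)
    show "(\<lambda>n. (C * norm x) * K (Suc n)) \<longlonglongrightarrow> 0"
      unfolding K using binc_tendsto_0[of "1 - a"] a
      by (intro tendsto_mult_right_zero) auto
    show "I \<longlonglongrightarrow> (pi / sin (pi * a)) *\<^sub>R fpow T a x"
      unfolding I[abs_def] using fpow_sums[of a x] a
      by (intro tendsto_scaleR tendsto_const) (auto simp: sums_def simp del: sum.lessThan_Suc
          intro: LIMSEQ_Suc[where f = "\<lambda>n. \<Sum>k<n. binc (- a) k *\<^sub>R (T ^^ k) x"])
    fix n :: nat and t :: real assume "t \<in> {0<..}"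
    then have t: "t > 0" by simp
    define q where "q = 1 / (1 + t)"
    have q: "0 < q" "q < 1" "(1 + t) * q = 1" "t * q = 1 - q" using t by (auto simp: q_def field_simps)
    have R: "(\<lambda>k. q ^ Suc k *\<^sub>R (T ^^ k) x) sums R t"
      unfolding R_def q_def by (rule resolvent_sums[OF t])
    have "t *\<^sub>R R t + (R t - T (R t)) = x"
      unfolding R_def by (rule resolvent_eq[OF t])
    then have AR: "R t - T (R t) = x - t *\<^sub>R R t"
      by (simp add: algebra_simps)
    have "F n t = t powr (a - 1) *\<^sub>R (x - t *\<^sub>R (\<Sum>k<Suc n. q ^ Suc k *\<^sub>R (T ^^ k) x))"
    proof -
      have "h (Suc k) t - h (Suc (Suc k)) t = t powr (a - 1) * (t * q ^ Suc (Suc k))" for k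
      proof -
        have "h (Suc k) t - h (Suc (Suc k)) t = t powr (a - 1) * (q ^ Suc k * (1 - q))"
          by (simp add: h_def algebra_simps flip: q_def)
        then show ?thesis
          by (simp only: q(4)[symmetric]) (simp add: mult_ac)
      qed
      moreover have "h 1 t = t powr (a - 1) * (1 - t * q)"
        using q(4) by (simp add: h_def flip: q_def)
      ultimately have "F n t = (t powr (a - 1) * (1 - t * q)) *\<^sub>R x
          - (t powr (a - 1) * t) *\<^sub>R (\<Sum>k<n. q ^ Suc (Suc k) *\<^sub>R (T ^^ Suc k) x)"
        by (simp only: F_def scaleR_sum_right scaleR_scaleR mult.assoc)
      moreover have "(\<Sum>k<Suc n. q ^ Suc k *\<^sub>R (T ^^ k) x)
          = q *\<^sub>R x + (\<Sum>k<n. q ^ Suc (Suc k) *\<^sub>R (T ^^ Suc k) x)"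
        by (simp only: sum.lessThan_Suc_shift funpow_0 power_Suc0_right)
      ultimately show ?thesis
        by (simp only: scaleR_diff_right scaleR_add_right scaleR_diff_left right_diff_distrib
            scaleR_scaleR mult.assoc mult_1_right diff_diff_eq)
    qed
    then have "norm (t powr (a - 1) *\<^sub>R (R t - T (R t)) - F n t)
        = t powr (a - 1) * (t * norm (R t - (\<Sum>k<Suc n. q ^ Suc k *\<^sub>R (T ^^ k) x)))"
      using t by (simp only: AR scaleR_diff_right[symmetric])
        (simp add: scaleR_diff_right[symmetric] norm_minus_commute del: sum.lessThan_Suc)
    also have "R t - (\<Sum>k<Suc n. q ^ Suc k *\<^sub>R (T ^^ k) x)
        = (\<Sum>k. q ^ Suc (k + Suc n) *\<^sub>R (T ^^ (k + Suc n)) x)"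
      using suminf_minus_initial_segment[OF sums_summable[OF R], of "Suc n"] sums_unique[OF R]
      by simp
    also have "norm (\<dots>) \<le> (\<Sum>k. q ^ k * (q ^ Suc (Suc n) * (C * norm x)))"
    proof (rule norm_suminf_le)
      show "norm (q ^ Suc (k + Suc n) *\<^sub>R (T ^^ (k + Suc n)) x) \<le> q ^ k * (q ^ Suc (Suc n) * (C * norm x))" for k
      proof -
        have "norm (q ^ m *\<^sub>R (T ^^ l) x) \<le> q ^ m * (C * norm x)" for m l
          using q by (simp add: mult_left_mono norm_power_le)
        moreover have "q ^ Suc (k + Suc n) * (C * norm x) = q ^ k * (q ^ Suc (Suc n) * (C * norm x))"
          by (simp add: power_add mult_ac)
        ultimately show ?thesis by metis
      qed
      show "summable (\<lambda>k. q ^ k * (q ^ Suc (Suc n) * (C * norm x)))"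
        using q by (intro summable_mult2) (simp add: summable_geometric)
    qed
    also have "\<dots> = (1 / (1 - q)) * (q ^ Suc (Suc n) * (C * norm x))"
      using q by (subst suminf_mult2[symmetric]) (auto simp: summable_geometric suminf_geometric)
    \<comment> \<open>By \<open>1 - q = t q\<close> the factor \<open>t\<close> and one power of
      \<open>q\<close> cancel, so the exponent drops from \<open>n + 2\<close> to
      \<open>n + 1\<close>.\<close>
    also have "t powr (a - 1) * (t * ((1 / (1 - q)) * (q ^ Suc (Suc n) * (C * norm x))))
        = (C * norm x) * h (Suc n) t"
      using t q by (simp add: h_def q(4)[symmetric] flip: q_def)
    finally show "norm (t powr (a - 1) *\<^sub>R (R t - T (R t)) - F n t) \<le> (C * norm x) * h (Suc n) t"
      using t by (simp add: mult_left_mono)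
  qed
  then show ?thesis by (simp add: R_def)
qed

lemma balakrishnan_eq_fpow:
  assumes "0 < a" "a < 1"
  shows "balakrishnan (\<lambda>z. z - T z) a x = fpow T a x"
proof -
  have "sin (pi * a) > 0" using assms by (intro sin_gt_zero) auto
  then show ?thesis
    unfolding balakrishnan_def using has_integral_balakrishnan[OF assms, of x]
    by (simp add: integral_unique)
qed

lemma frac_power_eq_fpow:
  assumes "a > 0"
  shows "frac_power (\<lambda>z. z - T z) a x = fpow T a x"
proof (cases "a = of_int \<lfloor>a\<rfloor>")
  case True
  then have "real (nat \<lfloor>a\<rfloor>) = a" using assms by linarith
  then show ?thesis
    using True power_minus_fpow[of 0 "nat \<lfloor>a\<rfloor>" x] by (simp add: frac_power_def)
next
  case False
  have "frac a \<noteq> 0" using False by (simp add: frac_def)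
  then have "0 < frac a" "frac a < 1" using frac_ge_0[of a] frac_lt_1[of a] by linarith+
  moreover have "real (nat \<lfloor>a\<rfloor>) + frac a = a" using assms by (simp add: frac_def)
  ultimately show ?thesis
    using False power_minus_fpow[of "frac a" "nat \<lfloor>a\<rfloor>" x]
    by (simp add: frac_power_def balakrishnan_eq_fpow flip: frac_def)
qed

end

section \<open>Square functions of R-Ritt operators\<close>

text \<open>The definition covers initial segments; a bijection transports it to arbitrary finite
  index sets. Raising the constant to at least 1 makes it positive.\<close>

lemma R_bounded_finite_sets:
  assumes "R_bounded F"
  shows "\<exists>C\<ge>1. \<forall>K Q y. finite K \<longrightarrow> (\<forall>k\<in>K. Q k \<in> F) \<longrightarrow>
    rad_norm K (\<lambda>k. Q k (y k)) \<le> C * rad_norm K y"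
proof -
  obtain C where C: "\<And>n Q y. (\<And>k. k < n \<Longrightarrow> Q k \<in> F) \<Longrightarrow>
      rad_norm {..<n::nat} (\<lambda>k. Q k (y k)) \<le> C * rad_norm {..<n} y"
    using assms unfolding R_bounded_def by blast
  have "rad_norm K (\<lambda>k. Q k (y k)) \<le> max 1 C * rad_norm K y"
    if K: "finite K" and Q: "\<And>k. k \<in> K \<Longrightarrow> Q k \<in> F" for K Q y
  proof -
    obtain h where h: "bij_betw h {..<card K} K"
      using ex_bij_betw_nat_finite[OF K] by (auto simp: atLeast0LessThan)
    have re: "rad_norm K z = rad_norm {..<card K} (\<lambda>i. z (h i))" for z :: "nat \<Rightarrow> 'a"
      using rad_norm_reindex[OF bij_betw_imp_inj_on[OF h]] by (simp add: bij_betw_imp_surj_on[OF h])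
    have "rad_norm {..<card K} (\<lambda>i. Q (h i) (y (h i))) \<le> C * rad_norm {..<card K} (\<lambda>i. y (h i))"
      using Q bij_betwE[OF h] by (intro C) auto
    also have "\<dots> \<le> max 1 C * rad_norm {..<card K} (\<lambda>i. y (h i))"
      by (intro mult_right_mono) auto
    finally show ?thesis by (simp only: re)
  qed
  then show ?thesis by (intro exI[of _ "max 1 C"]) auto
qed

lemma rad_norm_Un:
  assumes "finite K" "finite L"
  shows "rad_norm (K \<union> L) y \<le> rad_norm K y + rad_norm L y"
proof -
  let ?y = "\<lambda>k. if k \<in> K then y k else 0" and ?z = "\<lambda>k. if k \<in> K then 0 else y k"
  have "rad_norm (K \<union> L) y = rad_norm (K \<union> L) (\<lambda>k. ?y k + ?z k)"
    by (rule rad_norm_cong) auto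
  also have "\<dots> \<le> rad_norm (K \<union> L) ?y + rad_norm (K \<union> L) ?z"
    by (rule rad_norm_add)
  also have "rad_norm (K \<union> L) ?y = rad_norm K ?y"
    using assms by (intro rad_norm_superset) auto
  also have "\<dots> = rad_norm K y"
    by (rule rad_norm_cong) auto
  also have "rad_norm (K \<union> L) ?z = rad_norm (L - K) ?z"
    using assms by (intro rad_norm_superset) auto
  also have "\<dots> = rad_norm (L - K) y"
    by (rule rad_norm_cong) auto
  also have "\<dots> \<le> rad_norm L y"
    using assms by (intro rad_norm_mono) auto
  finally show ?thesis by simp
qed

lemma rad_norm_empty [simp]: "rad_norm {} y = 0"
  by (simp add: rad_norm_def)

text \<open>The window for \<open>u\<close> starts at \<open>2 m - 1\<close> because raising the exponent estimates the entry \<open>m'\<close> of \<open>u\<close> by the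
  entry \<open>\<lceil>m' / 2\<rceil>\<close> of \<open>y\<close>.\<close>
definition rad_dominated ::
    "real \<Rightarrow> (nat \<Rightarrow> 'a::real_normed_vector) \<Rightarrow> (nat \<Rightarrow> 'a) \<Rightarrow> bool" where
  "rad_dominated C y u \<longleftrightarrow>
     (\<forall>m e. m \<ge> 1 \<longrightarrow> (\<forall>n. rad_norm {m..n} y \<le> e) \<longrightarrow> (\<forall>n. rad_norm {2 * m - 1..n} u \<le> C * e))"

text \<open>\<open>lim\<close> is meaningful only for a convergent sequence. The norms increase with
  \<open>n\<close>, and the Cauchy criterion bounds them by one initial norm plus 1.\<close>

lemma rad_cauchy_LIMSEQ:
  assumes "rad_cauchy y"
  shows "(\<lambda>n. rad_norm {1..n} y) \<longlonglongrightarrow> lim (\<lambda>n. rad_norm {1..n} y)"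
    and "rad_norm {1..n} y \<le> lim (\<lambda>n. rad_norm {1..n} y)"
proof -
  obtain M where M: "\<And>m n. M \<le> m \<Longrightarrow> m \<le> n \<Longrightarrow> rad_norm {m..n} y < 1"
    using assms unfolding rad_cauchy_def by (meson zero_less_one)
  have "rad_norm {1..n} y \<le> rad_norm {1..M} y + 1" for n
  proof (cases "M \<le> n")
    case True
    have "rad_norm {1..n} y \<le> rad_norm ({1..M} \<union> {M..n}) y"
      by (rule rad_norm_mono) auto
    also have "\<dots> \<le> rad_norm {1..M} y + rad_norm {M..n} y"
      by (rule rad_norm_Un) auto
    finally show ?thesis using M[OF order.refl True] by linarith
  next
    case False
    then have "rad_norm {1..n} y \<le> rad_norm {1..M} y"
      by (intro rad_norm_mono) auto
    then show ?thesis by linarith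
  qed
  moreover have inc: "incseq (\<lambda>n. rad_norm {1..n} y)"
    by (intro incseq_SucI rad_norm_mono) auto
  ultimately obtain L where L: "(\<lambda>n. rad_norm {1..n} y) \<longlonglongrightarrow> L"
    using incseq_convergent by blast
  then show "(\<lambda>n. rad_norm {1..n} y) \<longlonglongrightarrow> lim (\<lambda>n. rad_norm {1..n} y)"
    by (simp add: limI)
  then show "rad_norm {1..n} y \<le> lim (\<lambda>n. rad_norm {1..n} y)"
    by (rule incseq_le[OF inc])
qed

text \<open>Windows that start late transport the Cauchy criterion, and the window at
  \<open>m = 1\<close>, where \<open>2 * m - 1 = 1\<close>, compares the full norms.\<close>

lemma rad_dominated_cauchy:
  assumes dom: "rad_dominated C y u" and C: "C > 0" and y: "rad_cauchy y"
  shows "rad_cauchy u"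
    and "lim (\<lambda>n. rad_norm {1..n} u) \<le> C * lim (\<lambda>n. rad_norm {1..n} y)"
proof -
  show u: "rad_cauchy u"
    unfolding rad_cauchy_def
  proof (intro allI impI)
    fix e :: real assume "e > 0"
    then have e: "e / (2 * C) > 0" using C by simp
    then obtain M where M: "M \<ge> 1" "\<And>m n. M \<le> m \<Longrightarrow> m \<le> n \<Longrightarrow> rad_norm {m..n} y < e / (2 * C)"
      using y unfolding rad_cauchy_def by meson
    have "rad_norm {M..n} y \<le> e / (2 * C)" for n
      using M(2)[of M n] e by (cases "M \<le> n") auto
    then have "rad_norm {2 * M - 1..n} u \<le> C * (e / (2 * C))" for n
      using dom M(1) unfolding rad_dominated_def by blast
    moreover have "C * (e / (2 * C)) < e" using C \<open>e > 0\<close> by simp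
    ultimately have "rad_norm {2 * M - 1..n} u < e" for n
      using order.strict_trans1 by blast
    moreover have "rad_norm {m..n} u \<le> rad_norm {2 * M - 1..n} u" if "2 * M - 1 \<le> m" for m n
      using that by (intro rad_norm_mono) auto
    ultimately show "\<exists>M\<ge>1. \<forall>m n. M \<le> m \<longrightarrow> m \<le> n \<longrightarrow> rad_norm {m..n} u < e"
      using M(1) order.strict_trans1 by (intro exI[of _ "2 * M - 1"]) fastforce
  qed
  have "rad_norm {1..n} u \<le> C * lim (\<lambda>n. rad_norm {1..n} y)" for n
    using dom[unfolded rad_dominated_def, rule_format, of 1] rad_cauchy_LIMSEQ(2)[OF y] by simp
  then show "lim (\<lambda>n. rad_norm {1..n} u) \<le> C * lim (\<lambda>n. rad_norm {1..n} y)"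
    by (intro LIMSEQ_le_const2[OF rad_cauchy_LIMSEQ(1)[OF u]]) auto
qed

text \<open>It telescopes \<open>binc c (n + 1) - binc c n = binc (c - 1) (n + 1)\<close>. A factor
  \<open>I - T\<close> on the vector is traded for a shift of the coefficient parameter by 1; the
  boundary term is what each later limit has to remove.\<close>

lemma abel_summation:
  fixes v :: "'a::real_vector"
  assumes lin: "\<And>n x y. (T ^^ n) (x - y) = (T ^^ n) x - (T ^^ n) y"
  shows "(\<Sum>k\<le>n. binc (c - 1) k *\<^sub>R (T ^^ k) v)
    = (\<Sum>k\<le>n. binc c k *\<^sub>R (T ^^ k) (v - T v)) + binc c n *\<^sub>R (T ^^ Suc n) v"
proof (induction n)
  case 0
  then show ?case by simp
next
  case (Suc n)
  have "binc c (Suc n) = binc c n + binc (c - 1) (Suc n)"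
    using sum_binc[of "c - 1" "Suc n"] sum_binc[of "c - 1" n] by simp
  moreover have "(T ^^ Suc n) (v - T v) = (T ^^ Suc n) v - (T ^^ Suc (Suc n)) v"
    using lin[of "Suc n" v "T v"] by (simp add: funpow_swap1)
  ultimately show ?case
    using Suc by (simp only: sum.atMost_Suc scaleR_diff_right scaleR_add_left)
      (simp add: algebra_simps del: funpow.simps)
qed

section \<open>Decay of powers and series that lower the exponent\<close>

locale ritt = power_bounded +
  assumes norm_ritt_le: "norm (real n *\<^sub>R ((T ^^ n) x - (T ^^ (n - 1)) x)) \<le> C * norm x"
begin

lemma norm_power_minus_le: "norm ((T ^^ n) (x - T x)) \<le> C * norm x / real (Suc n)"
proof -
  have "norm (real (Suc n) *\<^sub>R ((T ^^ Suc n) x - (T ^^ n) x)) \<le> C * norm x"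
    using norm_ritt_le[of "Suc n" x] by (simp only: diff_Suc_1)
  moreover have "(T ^^ n) (x - T x) = - ((T ^^ Suc n) x - (T ^^ n) x)"
    by (simp only: power_diff funpow_Suc_right comp_def minus_diff_eq)
  ultimately have "real (Suc n) * norm ((T ^^ n) (x - T x)) \<le> C * norm x"
    by (simp only: norm_minus_cancel norm_scaleR abs_of_nat)
  then show ?thesis by (simp add: field_simps)
qed

text \<open>The boundary coefficient \<open>binc (1 - a) n\<close> tends to 0, so power boundedness
  alone removes the boundary term.\<close>

lemma abel_limit:
  assumes "0 < a" "a \<le> 1"
  shows "(\<lambda>n. \<Sum>k\<le>n. binc (1 - a) k *\<^sub>R (T ^^ k) (v - T v)) \<longlonglongrightarrow> fpow T a v"
proof -
  have "(\<lambda>n. \<Sum>k\<le>n. binc (- a) k *\<^sub>R (T ^^ k) v) \<longlonglongrightarrow> fpow T a v"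
    using fpow_sums[of a v] assms by (simp add: sums_def_le)
  moreover have "(\<lambda>n. binc (1 - a) n *\<^sub>R (T ^^ Suc n) v) \<longlonglongrightarrow> 0"
  proof (rule Lim_null_comparison)
    show "(\<lambda>n. binc (1 - a) n * (C * norm v)) \<longlonglongrightarrow> 0"
      using binc_tendsto_0[of "1 - a"] assms by (intro tendsto_mult_left_zero) auto
    show "\<forall>\<^sub>F n in sequentially. norm (binc (1 - a) n *\<^sub>R (T ^^ Suc n) v) \<le> binc (1 - a) n * (C * norm v)"
      using binc_nonneg[of "1 - a"] assms norm_power_le
      by (intro always_eventually allI) (simp add: mult_left_mono del: funpow.simps)
  qed
  ultimately have "(\<lambda>n. (\<Sum>k\<le>n. binc (- a) k *\<^sub>R (T ^^ k) v) - binc (1 - a) n *\<^sub>R (T ^^ Suc n) v)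
      \<longlonglongrightarrow> fpow T a v - 0"
    by (rule tendsto_diff)
  moreover have "(\<Sum>k\<le>n. binc (- a) k *\<^sub>R (T ^^ k) v) - binc (1 - a) n *\<^sub>R (T ^^ Suc n) v
      = (\<Sum>k\<le>n. binc (1 - a) k *\<^sub>R (T ^^ k) (v - T v))" for n
    using abel_summation[of T "1 - a" v n, OF power_diff] by simp
  ultimately show ?thesis by simp
qed

text \<open>By \<open>abel_limit\<close> the vector is a limit of finite combinations of the
  \<open>T^k (v - T v)\<close>. On these \<open>T^n\<close> decays like \<open>1 / n\<close> by the
  Ritt estimate, and the uniform power bound extends the convergence to the limit.\<close>

lemma power_fpow_tendsto_0_aux:
  assumes "0 < a" "a \<le> 1"
  shows "(\<lambda>n. (T ^^ n) (fpow T a v)) \<longlonglongrightarrow> 0"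
proof (rule LIMSEQ_I)
  fix e :: real assume e: "e > 0"
  define w where "w N = (\<Sum>k\<le>N. binc (1 - a) k *\<^sub>R (T ^^ k) (v - T v))" for N
  have "w \<longlonglongrightarrow> fpow T a v"
    using abel_limit[OF assms, of v] by (simp add: w_def[abs_def])
  then have "(\<lambda>N. C * norm (w N - fpow T a v)) \<longlonglongrightarrow> 0"
    by (intro tendsto_mult_right_zero tendsto_norm_zero LIM_zero)
  then have "\<forall>\<^sub>F N in sequentially. C * norm (w N - fpow T a v) < e / 2"
    using e by (intro order_tendstoD) auto
  then have "\<exists>N. C * norm (w N - fpow T a v) < e / 2"
    by (rule eventually_happens'[OF sequentially_bot])
  then obtain N where N: "C * norm (fpow T a v - w N) < e / 2"
    by (auto simp: norm_minus_commute)
  have "(\<lambda>n. (T ^^ n) (w N)) \<longlonglongrightarrow> 0"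
  proof -
    have "(\<lambda>n. (T ^^ n) ((T ^^ k) (v - T v))) \<longlonglongrightarrow> 0" for k
    proof (rule Lim_null_comparison)
      show "\<forall>\<^sub>F n in sequentially. norm ((T ^^ n) ((T ^^ k) (v - T v))) \<le> C * norm ((T ^^ k) v) / real (Suc n)"
      proof (intro always_eventually allI)
        have "(T ^^ k) (v - T v) = (T ^^ k) v - T ((T ^^ k) v)"
          by (simp add: power_diff funpow_swap1)
        then show "norm ((T ^^ n) ((T ^^ k) (v - T v))) \<le> C * norm ((T ^^ k) v) / real (Suc n)" for n
          using norm_power_minus_le[of n "(T ^^ k) v"] by simp
      qed
      show "(\<lambda>n. C * norm ((T ^^ k) v) / real (Suc n)) \<longlonglongrightarrow> 0"
        by (intro LIMSEQ_Suc[where f = "\<lambda>n. C * norm ((T ^^ k) v) / real n"] lim_const_over_n)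
    qed
    then have "(\<lambda>n. \<Sum>k\<le>N. binc (1 - a) k *\<^sub>R (T ^^ n) ((T ^^ k) (v - T v))) \<longlonglongrightarrow> (\<Sum>k\<le>N. binc (1 - a) k *\<^sub>R 0)"
      by (intro tendsto_intros)
    then show ?thesis by (simp add: w_def power_sum power_scaleR)
  qed
  then obtain M where M: "\<And>n. n \<ge> M \<Longrightarrow> norm ((T ^^ n) (w N)) < e / 2"
    using LIMSEQ_D[of "\<lambda>n. (T ^^ n) (w N)" 0 "e / 2"] e by auto
  have "norm ((T ^^ n) (fpow T a v) - 0) < e" if "n \<ge> M" for n
  proof -
    have "(T ^^ n) (fpow T a v) = (T ^^ n) (fpow T a v - w N) + (T ^^ n) (w N)"
      by (simp add: power_diff)
    then have "norm ((T ^^ n) (fpow T a v)) \<le> norm ((T ^^ n) (fpow T a v - w N)) + norm ((T ^^ n) (w N))"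
      by (metis norm_triangle_ineq)
    also have "\<dots> < e / 2 + e / 2"
      using norm_power_le[of n "fpow T a v - w N"] N M[OF that] by linarith
    finally show ?thesis by simp
  qed
  then show "\<exists>M. \<forall>n\<ge>M. norm ((T ^^ n) (fpow T a v) - 0) < e" by blast
qed

lemma power_fpow_tendsto_0:
  assumes "a > 0"
  shows "(\<lambda>n. (T ^^ n) (fpow T a x)) \<longlonglongrightarrow> 0"
proof -
  have "fpow T a x = fpow T (min a 1) (fpow T (a - min a 1) x)"
    using assms by (subst fpow_add) auto
  then show ?thesis
    using power_fpow_tendsto_0_aux[of "min a 1"] assms by simp
qed

text \<open>The sum telescopes with remainder \<open>T^(n+1) A^a x\<close>. The explicit factor 1
  displays the coefficient sequence in the form that \<open>sq_le_down\<close> expects.\<close>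

lemma fpow_down_one:
  assumes "a > 0"
  shows "(\<lambda>n. \<Sum>k\<le>n. 1 *\<^sub>R (T ^^ k) (fpow T (a + 1) x)) \<longlonglongrightarrow> fpow T a x"
proof -
  have "(\<lambda>n. fpow T a x - (T ^^ Suc n) (fpow T a x)) \<longlonglongrightarrow> fpow T a x - 0"
    by (intro tendsto_diff tendsto_const LIMSEQ_Suc power_fpow_tendsto_0 assms)
  moreover have "fpow T a x - (T ^^ Suc n) (fpow T a x) = (\<Sum>k\<le>n. 1 *\<^sub>R (T ^^ k) (fpow T (a + 1) x))" for n
  proof -
    have "fpow T (a + 1) x = fpow T a x - T (fpow T a x)"
      using assms by (simp add: fpow_add add.commute flip: fpow_1)
    then have "(T ^^ k) (fpow T (a + 1) x) = (T ^^ k) (fpow T a x) - (T ^^ Suc k) (fpow T a x)" for k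
      by (simp only: power_diff funpow_Suc_right comp_def)
    then show ?thesis
      using sum_telescope[of "\<lambda>k. (T ^^ k) (fpow T a x)" n] by (simp del: funpow.simps)
  qed
  ultimately show ?thesis by simp
qed

text \<open>A second Abel summation on top of \<open>abel_limit\<close>. The boundary coefficient
  now grows like \<open>n^(1-t)\<close>; the Ritt decay \<open>1 / n\<close> of
  \<open>T^n A v\<close> beats it and leaves \<open>n^(-t)\<close>. The drop \<open>2 - t\<close> is
  at least 1, as the Hardy bound demands.\<close>

lemma fpow_down_two:
  assumes a: "a \<ge> 0" and t: "0 < t" "t \<le> 1"
  shows "(\<lambda>n. \<Sum>k\<le>n. binc (2 - t) k *\<^sub>R (T ^^ k) (fpow T (a + 2) x)) \<longlonglongrightarrow> fpow T (a + t) x"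
proof -
  define v where "v = fpow T a x"
  define w where "w = v - T v"
  have w2: "w - T w = fpow T (a + 2) x"
    using a by (simp add: w_def v_def fpow_add add.commute flip: fpow_1)
  have vt: "fpow T t v = fpow T (a + t) x"
    using a t by (simp add: v_def fpow_add add.commute)
  have "(\<lambda>n. \<Sum>k\<le>n. binc (1 - t) k *\<^sub>R (T ^^ k) w) \<longlonglongrightarrow> fpow T t v"
    unfolding w_def by (rule abel_limit[OF t])
  moreover have "(\<lambda>n. binc (2 - t) n *\<^sub>R (T ^^ Suc n) w) \<longlonglongrightarrow> 0"
  proof (rule Lim_null_comparison)
    show "(\<lambda>n. exp (1 - t) * C * norm v * real (Suc n) powr (- t)) \<longlonglongrightarrow> 0"
      using t by (intro tendsto_mult_right_zero tendsto_neg_powr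
          filterlim_compose[OF filterlim_real_sequentially filterlim_Suc]) auto
    have "norm (binc (2 - t) n *\<^sub>R (T ^^ Suc n) w) \<le> exp (1 - t) * C * norm v * real (Suc n) powr (- t)" for n
    proof -
      have b: "0 \<le> binc (2 - t) n" "binc (2 - t) n \<le> exp (1 - t) * real (Suc n) powr (1 - t)"
        using binc_nonneg[of "2 - t"] binc_le_powr_large[of "2 - t" n] t by auto
      have "norm ((T ^^ Suc n) w) \<le> C * norm v / real (Suc (Suc n))"
        unfolding w_def by (rule norm_power_minus_le)
      also have "\<dots> \<le> C * norm v / real (Suc n)"
        using C_nonneg[of v] by (intro divide_left_mono) auto
      finally have "norm (binc (2 - t) n *\<^sub>R (T ^^ Suc n) w)
          \<le> (exp (1 - t) * real (Suc n) powr (1 - t)) * (C * norm v / real (Suc n))"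
        using b by (simp only: norm_scaleR abs_of_nonneg) (intro mult_mono, auto)
      also have "\<dots> = exp (1 - t) * C * norm v * (real (Suc n) powr (1 - t) / real (Suc n) powr 1)"
        by simp
      also have "real (Suc n) powr (1 - t) / real (Suc n) powr 1 = real (Suc n) powr (- t)"
        by (subst powr_diff[symmetric]) simp
      finally show ?thesis .
    qed
    then show "\<forall>\<^sub>F n in sequentially. norm (binc (2 - t) n *\<^sub>R (T ^^ Suc n) w)
        \<le> exp (1 - t) * C * norm v * real (Suc n) powr (- t)"
      by simp
  qed
  ultimately have "(\<lambda>n. (\<Sum>k\<le>n. binc (1 - t) k *\<^sub>R (T ^^ k) w) - binc (2 - t) n *\<^sub>R (T ^^ Suc n) w)
      \<longlonglongrightarrow> fpow T t v - 0"
    by (rule tendsto_diff)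
  moreover have "(\<Sum>k\<le>n. binc (1 - t) k *\<^sub>R (T ^^ k) w) - binc (2 - t) n *\<^sub>R (T ^^ Suc n) w
      = (\<Sum>k\<le>n. binc (2 - t) k *\<^sub>R (T ^^ k) (w - T w))" for n
    using abel_summation[of T "2 - t" w n, OF power_diff] by simp
  ultimately show ?thesis by (simp add: w2 vt)
qed

end

section \<open>Comparison of square functions\<close>

definition sq_seq :: "('a::banach \<Rightarrow> 'a) \<Rightarrow> real \<Rightarrow> 'a \<Rightarrow> nat \<Rightarrow> 'a" where
  "sq_seq T a x k = real k powr (a - 1/2) *\<^sub>R (T ^^ (k - 1)) (fpow T a x)"

definition sq_le :: "('a::banach \<Rightarrow> 'a) \<Rightarrow> real \<Rightarrow> real \<Rightarrow> bool" where
  "sq_le T b a \<longleftrightarrow> (\<exists>C>0. \<forall>x. sq_norm T b x \<le> ereal C * sq_norm T a x)"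

lemma sq_le_trans:
  assumes "sq_le T c b" "sq_le T b a"
  shows "sq_le T c a"
proof -
  obtain C where C: "C > 0" "\<And>x. sq_norm T c x \<le> ereal C * sq_norm T b x"
    using assms(1) by (auto simp: sq_le_def)
  obtain D where D: "D > 0" "\<And>x. sq_norm T b x \<le> ereal D * sq_norm T a x"
    using assms(2) by (auto simp: sq_le_def)
  have "sq_norm T c x \<le> ereal (C * D) * sq_norm T a x" for x
  proof -
    have "sq_norm T c x \<le> ereal C * sq_norm T b x" by (rule C)
    also have "\<dots> \<le> ereal C * (ereal D * sq_norm T a x)"
      using C D by (intro ereal_mult_left_mono) auto
    also have "\<dots> = ereal (C * D) * sq_norm T a x"
      by (simp add: mult.assoc[symmetric])
    finally show ?thesis .
  qed
  then show ?thesis using C D by (auto simp: sq_le_def intro: exI[of _ "C * D"])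
qed

lemma sq_le_refl: "sq_le T a a"
  by (auto simp: sq_le_def intro!: exI[of _ 1] simp flip: one_ereal_def)

context power_bounded
begin

lemma sq_norm_eq:
  assumes "a > 0"
  shows "sq_norm T a x = (if rad_cauchy (sq_seq T a x)
    then ereal (lim (\<lambda>N. rad_norm {1..N} (sq_seq T a x))) else \<infinity>)"
  using assms by (simp add: sq_norm_def sq_seq_def[abs_def] frac_power_eq_fpow Let_def)

lemma sq_le_dominated:
  assumes "a > 0" "b > 0" "B > 0" and dom: "\<And>x. rad_dominated B (sq_seq T a x) (sq_seq T b x)"
  shows "sq_le T b a"
  unfolding sq_le_def
proof (intro exI[of _ B] conjI allI)
  fix x
  show "sq_norm T b x \<le> ereal B * sq_norm T a x"
    using assms rad_dominated_cauchy[OF dom \<open>B > 0\<close>, of x] by (auto simp: sq_norm_eq)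
qed fact

text \<open>With \<open>k = m + j\<close> the series becomes the matrix \<open>a m k\<close> acting
  on the sequence of exponent \<open>c\<close>. As \<open>c - b - 1\<close> is nonnegative and k - m
  + 1 \<le> k, the coefficient is at most \<open>D * k^(c-b-1)\<close>; together with
  \<open>k^(-(c-1/2))\<close> this gives \<open>k^(-b-1/2)\<close>, the Hardy kernel.\<close>

lemma sq_le_down:
  assumes b: "b > 0" and c: "b + 1 \<le> c" and D: "D > 0"
    and e: "\<And>j. \<bar>e j\<bar> \<le> D * real (Suc j) powr (c - b - 1)"
    and lim: "\<And>x. (\<lambda>n. \<Sum>j\<le>n. e j *\<^sub>R (T ^^ j) (fpow T c x)) \<longlonglongrightarrow> fpow T b x"
  shows "sq_le T b c"
proof (rule sq_le_dominated[where B = "2 * D / (1 - 2 powr - b)"])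
  define a where "a m k = real m powr (b - 1/2) * e (k - m) * real k powr (- (c - 1/2))" for m k
  have a_le: "\<bar>a m k\<bar> \<le> D * real m powr (b - 1/2) * real k powr (- b - 1/2)" if "0 < m" "m \<le> k" for m k
  proof -
    have k: "k > 0" using that by simp
    have "\<bar>e (k - m)\<bar> \<le> D * real (Suc (k - m)) powr (c - b - 1)" by (rule e)
    also have "\<dots> \<le> D * real k powr (c - b - 1)"
      using that c D by (intro mult_left_mono powr_mono2) auto
    finally have "\<bar>a m k\<bar> \<le> real m powr (b - 1/2) * (D * real k powr (c - b - 1)) * real k powr (- (c - 1/2))"
      unfolding a_def abs_mult by (intro mult_mono) auto
    also have "\<dots> = D * real m powr (b - 1/2) * (real k powr (c - b - 1) * real k powr (- (c - 1/2)))"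
      by simp
    also have "real k powr (c - b - 1) * real k powr (- (c - 1/2)) = real k powr (- b - 1/2)"
      unfolding powr_add[symmetric] by (rule arg_cong) simp
    finally show ?thesis .
  qed
  show "0 < 2 * D / (1 - 2 powr - b)"
    using b D by (simp add: powr_less_one)
  show "rad_dominated (2 * D / (1 - 2 powr - b)) (sq_seq T c x) (sq_seq T b x)" for x
    unfolding rad_dominated_def
  proof (intro allI impI)
    fix m0 :: nat and \<epsilon> and n
    assume m0: "1 \<le> m0" and bound: "\<forall>n. rad_norm {m0..n} (sq_seq T c x) \<le> \<epsilon>"
    define u where "u K m = (\<Sum>k=m..K. a m k *\<^sub>R sq_seq T c x k)" for K m
    have "(\<lambda>K. u K m) \<longlonglongrightarrow> sq_seq T b x m" if "m \<in> {m0..n}" for m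
    \<comment> \<open>Replacing \<open>K\<close> by \<open>K + m\<close> lets the inner sum run over
      \<open>j\<close> from 0 to \<open>K\<close> and skips the values below \<open>m\<close>, where
      it is empty.\<close>
    proof (rule LIMSEQ_offset[of _ m])
      have m: "m > 0" using that m0 by auto
      have "u (K + m) m = real m powr (b - 1/2) *\<^sub>R (T ^^ (m - 1)) (\<Sum>j\<le>K. e j *\<^sub>R (T ^^ j) (fpow T c x))" for K
      proof -
        have "u (K + m) m = (\<Sum>j\<le>K. a m (j + m) *\<^sub>R sq_seq T c x (j + m))"
          unfolding u_def using sum.shift_bounds_cl_nat_ivl[of _ 0 m K] by (simp add: atLeast0AtMost)
        also have "\<dots> = (\<Sum>j\<le>K. real m powr (b - 1/2) *\<^sub>R (e j *\<^sub>R (T ^^ (m - 1)) ((T ^^ j) (fpow T c x))))"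
        proof (rule sum.cong)
          fix j
          have "real (j + m) powr (- (c - 1/2)) * real (j + m) powr (c - 1/2) = 1"
            using m by (simp flip: powr_add)
          then have "a m (j + m) * real (j + m) powr (c - 1/2) = real m powr (b - 1/2) * e j"
            by (simp only: a_def mult.assoc) simp
          moreover have "(T ^^ (j + m - 1)) (fpow T c x) = (T ^^ (m - 1)) ((T ^^ j) (fpow T c x))"
            using m by (simp add: add.commute flip: funpow_add_apply)
          ultimately show "a m (j + m) *\<^sub>R sq_seq T c x (j + m)
              = real m powr (b - 1/2) *\<^sub>R (e j *\<^sub>R (T ^^ (m - 1)) ((T ^^ j) (fpow T c x)))"
            by (simp only: sq_seq_def scaleR_scaleR)
        qed simp
        also have "\<dots> = real m powr (b - 1/2) *\<^sub>R (T ^^ (m - 1)) (\<Sum>j\<le>K. e j *\<^sub>R (T ^^ j) (fpow T c x))"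
          by (simp only: power_sum power_scaleR scaleR_sum_right)
        finally show ?thesis .
      qed
      then show "(\<lambda>K. u (K + m) m) \<longlonglongrightarrow> sq_seq T b x m"
        unfolding sq_seq_def
        by (simp only:) (intro tendsto_scaleR tendsto_const bounded_linear.tendsto[OF linear_power lim])
    qed
    then have "(\<lambda>K. rad_norm {m0..n} (u K)) \<longlonglongrightarrow> rad_norm {m0..n} (sq_seq T b x)"
      by (rule tendsto_rad_norm)
    moreover have "rad_norm {m0..n} (u K) \<le> 2 * D / (1 - 2 powr - b) * \<epsilon>" for K
    proof -
      have "rad_norm {m0..n} (u K) \<le> 2 * D / (1 - 2 powr - b) * rad_norm {m0..K} (sq_seq T c x)"
        unfolding u_def[abs_def] using b D m0 a_le by (intro rad_norm_hardy) auto
      also have "\<dots> \<le> 2 * D / (1 - 2 powr - b) * \<epsilon>"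
        using bound b D by (intro mult_left_mono) (auto simp: powr_less_one less_imp_le)
      finally show ?thesis .
    qed
    ultimately have "rad_norm {m0..n} (sq_seq T b x) \<le> 2 * D / (1 - 2 powr - b) * \<epsilon>"
      by (intro LIMSEQ_le_const2) auto
    \<comment> \<open>Lowering preserves the window starting at \<open>m0\<close>, and m0 \<le> 2 *
      m0 - 1 places the window of \<open>rad_dominated\<close> inside it.\<close>
    moreover have "rad_norm {2 * m0 - 1..n} (sq_seq T b x) \<le> rad_norm {m0..n} (sq_seq T b x)"
      using m0 by (intro rad_norm_mono) auto
    ultimately show "rad_norm {2 * m0 - 1..n} (sq_seq T b x) \<le> 2 * D / (1 - 2 powr - b) * \<epsilon>"
      by linarith
  qed
qed (use b c in auto)

text \<open>Splitting \<^term>\<open>T ^^ (m - 1)\<close> in the middle, half of the powers turn the additional factor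
  \<^term>\<open>\<lambda>z. z - T z\<close> into an R-bounded family while the other half stays with \<^const>\<open>sq_seq\<close>.\<close>
lemma sq_le_up_one:
  assumes a: "a > 0"
    and R: "R_bounded ((\<lambda>n. \<lambda>x. real n *\<^sub>R ((T ^^ n) x - (T ^^ (n - 1)) x)) ` {1..})"
  shows "sq_le T (a + 1) a"
proof -
  define Q where "Q n x = real n *\<^sub>R ((T ^^ n) x - (T ^^ (n - 1)) x)" for n x
  have Q: "R_bounded (Q ` {1..})" using R by (simp add: Q_def[abs_def])
  obtain B where B: "B \<ge> 1" and RB: "\<forall>K f y. finite K \<longrightarrow> (\<forall>k\<in>K. f k \<in> Q ` {1..}) \<longrightarrow>
      rad_norm K (\<lambda>k. f k (y k)) \<le> B * rad_norm K y"
    using R_bounded_finite_sets[OF Q] by blast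
  show ?thesis
  proof (rule sq_le_dominated[where B = "2 * (2 powr (a + 1/2) * B)"])
    show "0 < 2 * (2 powr (a + 1/2) * B)" using B by simp
    show "rad_dominated (2 * (2 powr (a + 1/2) * B)) (sq_seq T a x) (sq_seq T (a + 1) x)" for x
      unfolding rad_dominated_def
    proof (intro allI impI)
      fix m0 :: nat and e n
      assume m0: "1 \<le> m0" and bound: "\<forall>n. rad_norm {m0..n} (sq_seq T a x) \<le> e"
      let ?u = "sq_seq T (a + 1) x" and ?y = "sq_seq T a x"
      \<comment> \<open>The indices \<open>2 * k - j\<close> are treated by parity:
        \<open>j = 0\<close> gives the even ones, \<open>j = 1\<close> the odd ones. For fixed
        \<open>j\<close> distinct entries of \<open>?u\<close> then use distinct entries of
        \<open>?y\<close>.\<close>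
      have half: "rad_norm ((\<lambda>k. 2 * k - j) ` {m0..n}) ?u \<le> 2 powr (a + 1/2) * B * e" if j: "j \<le> 1" for j
      proof -
        \<comment> \<open>\<open>c k\<close> collects all scalars: the weight at
          \<open>2 * k - j\<close>, the inverse of the weight in \<open>?y k\<close>, and the
          inverse of the factor \<open>k + 1 - j\<close> in \<open>Q\<close>. The minus sign appears
          because \<open>Q\<close> contains \<open>T - I\<close> instead of
          \<open>I - T\<close>.\<close>
        define c where "c k = - (real (2 * k - j) powr (a + 1/2) * real k powr (1/2 - a) / real (k + 1 - j))" for k
        have u: "?u (2 * k - j) = c k *\<^sub>R Q (k + 1 - j) (?y k)" if "k \<in> {m0..n}" for k
        proof -
          have k: "k \<ge> 1" using that m0 by auto
          define z where "z = (T ^^ (k - 1)) (fpow T a x)"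
          have y: "?y k = real k powr (a - 1/2) *\<^sub>R z" by (simp add: sq_seq_def z_def)
          have "real k powr (1/2 - a) * real k powr (a - 1/2) = 1"
            using k by (simp flip: powr_add)
          then have c: "c k * real (k + 1 - j) * real k powr (a - 1/2) = - (real (2 * k - j) powr (a + 1/2))"
            using k j by (simp add: c_def)
          have "fpow T (a + 1) x = fpow T a x - T (fpow T a x)"
            using a by (simp add: fpow_add add.commute flip: fpow_1)
          moreover have i: "2 * k - j - 1 = (k - j) + (k - 1)" using k j by simp
          ultimately have "(T ^^ (2 * k - j - 1)) (fpow T (a + 1) x)
              = (T ^^ ((k - j) + (k - 1))) (fpow T a x) - (T ^^ Suc ((k - j) + (k - 1))) (fpow T a x)"
            by (simp only: power_diff funpow_Suc_right comp_def)
          also have "\<dots> = (T ^^ (k - j)) z - (T ^^ Suc (k - j)) z"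
            by (simp only: z_def funpow_add_apply flip: add_Suc)
          finally have Tz: "(T ^^ (2 * k - j - 1)) (fpow T (a + 1) x) = (T ^^ (k - j)) z - (T ^^ Suc (k - j)) z" .
          have "a + 1 - 1/2 = a + 1/2" by simp
          then have "?u (2 * k - j) = - (real (2 * k - j) powr (a + 1/2)) *\<^sub>R ((T ^^ Suc (k - j)) z - (T ^^ (k - j)) z)"
            by (simp only: sq_seq_def Tz) (simp add: scaleR_diff_right del: funpow.simps)
          also have "\<dots> = c k *\<^sub>R Q (k + 1 - j) (?y k)"
          proof -
            have "k + 1 - j = Suc (k - j)" using k j by simp
            then have "c k *\<^sub>R Q (k + 1 - j) (?y k)
                = (c k * real (k + 1 - j) * real k powr (a - 1/2)) *\<^sub>R ((T ^^ Suc (k - j)) z - (T ^^ (k - j)) z)"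
              by (simp only: Q_def y power_scaleR diff_Suc_1 scaleR_scaleR mult.assoc flip: scaleR_diff_right)
            then show ?thesis by (simp only: c)
          qed
          finally show ?thesis .
        qed
        \<comment> \<open>The bound uses 2 * k - j \<le> 2 * k and, since j \<le> 1, k + 1 - j \<ge>
          k; the remaining powers of \<open>k\<close> cancel.\<close>
        have c: "\<bar>c k\<bar> \<le> 2 powr (a + 1/2)" if "k \<in> {m0..n}" for k
        proof -
          have k: "k \<ge> 1" using that m0 by auto
          have "\<bar>c k\<bar> \<le> real (2 * k) powr (a + 1/2) * real k powr (1/2 - a) / real k"
            unfolding c_def abs_minus_cancel using k j a
            by (auto intro!: frac_le mult_right_mono powr_mono2 simp: abs_mult)
          also have "\<dots> = 2 powr (a + 1/2) * (real k powr (a + 1/2) * real k powr (1/2 - a) / real k powr 1)"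
            using k by (simp add: powr_mult)
          also have "real k powr (a + 1/2) * real k powr (1/2 - a) / real k powr 1 = 1"
            using k by (simp flip: powr_add)
          finally show ?thesis by simp
        qed
        have "inj_on (\<lambda>k. 2 * k - j) {m0..n}"
          using m0 j by (auto simp: inj_on_def)
        then have "rad_norm ((\<lambda>k. 2 * k - j) ` {m0..n}) ?u = rad_norm {m0..n} (\<lambda>k. ?u (2 * k - j))"
          by (rule rad_norm_reindex)
        also have "\<dots> = rad_norm {m0..n} (\<lambda>k. c k *\<^sub>R Q (k + 1 - j) (?y k))"
          by (rule rad_norm_cong) (rule u)
        also have "\<dots> \<le> 2 powr (a + 1/2) * rad_norm {m0..n} (\<lambda>k. Q (k + 1 - j) (?y k))"
          using c by (intro rad_norm_contraction) auto
        also have "\<dots> \<le> 2 powr (a + 1/2) * (B * rad_norm {m0..n} ?y)"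
          using m0 j by (intro mult_left_mono RB[rule_format]) auto
        also have "\<dots> \<le> 2 powr (a + 1/2) * (B * e)"
          using bound B by (intro mult_left_mono) auto
        finally show ?thesis by simp
      qed
      have "{2 * m0 - 1..n} \<subseteq> (\<lambda>k. 2 * k - 0) ` {m0..n} \<union> (\<lambda>k. 2 * k - 1) ` {m0..n}"
      proof
        fix m assume m: "m \<in> {2 * m0 - 1..n}"
        show "m \<in> (\<lambda>k. 2 * k - 0) ` {m0..n} \<union> (\<lambda>k. 2 * k - 1) ` {m0..n}"
        proof (cases "even m")
          case True
          then have "m = 2 * (m div 2) - 0" "m div 2 \<in> {m0..n}" using m m0 by auto
          then show ?thesis by blast
        next
          case False
          then have "m = 2 * ((m + 1) div 2) - 1" by presburger
          moreover from False have "(m + 1) div 2 \<in> {m0..n}" using m m0 by auto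
          ultimately show ?thesis by blast
        qed
      qed
      then have "rad_norm {2 * m0 - 1..n} ?u
          \<le> rad_norm ((\<lambda>k. 2 * k - 0) ` {m0..n} \<union> (\<lambda>k. 2 * k - 1) ` {m0..n}) ?u"
        by (intro rad_norm_mono) auto
      also have "\<dots> \<le> rad_norm ((\<lambda>k. 2 * k - 0) ` {m0..n}) ?u + rad_norm ((\<lambda>k. 2 * k - 1) ` {m0..n}) ?u"
        by (intro rad_norm_Un) auto
      also have "\<dots> \<le> 2 powr (a + 1/2) * B * e + 2 powr (a + 1/2) * B * e"
        by (intro add_mono half) auto
      also have "\<dots> = 2 * (2 powr (a + 1/2) * B) * e"
        by (simp only: mult_2 distrib_right)
      finally show "rad_norm {2 * m0 - 1..n} ?u \<le> 2 * (2 powr (a + 1/2) * B) * e" .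
    qed
  qed (use a in auto)
qed

lemma sq_le_up:
  assumes "a > 0"
    and "R_bounded ((\<lambda>n. \<lambda>x. real n *\<^sub>R ((T ^^ n) x - (T ^^ (n - 1)) x)) ` {1..})"
  shows "sq_le T (a + real n) a"
proof (induction n)
  case (Suc n)
  have "sq_le T (a + real n + 1) (a + real n)"
    using assms by (intro sq_le_up_one) auto
  then show ?case using Suc sq_le_trans by (fastforce simp: add_ac)
qed (simp add: sq_le_refl)

end

context ritt
begin

lemma sq_le_down_nat:
  assumes "b > 0"
  shows "sq_le T b (b + real n)"
proof (induction n)
  case (Suc n)
  have "sq_le T (b + real n) (b + real n + 1)"
    by (rule sq_le_down[where D = 1 and e = "\<lambda>_. 1"]) (use assms fpow_down_one in auto)
  then show ?case using Suc sq_le_trans by (fastforce simp: add_ac)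
qed (simp add: sq_le_refl)

lemma sq_le_down_frac:
  assumes "a > 0" "0 < t" "t \<le> 1"
  shows "sq_le T (a + t) (a + 2)"
proof (rule sq_le_down[where D = "exp (1 - t)" and e = "binc (2 - t)"])
  show "\<bar>binc (2 - t) j\<bar> \<le> exp (1 - t) * real (Suc j) powr (a + 2 - (a + t) - 1)" for j
    using binc_nonneg[of "2 - t" j] binc_le_powr_large[of "2 - t" j] assms by simp
  show "(\<lambda>n. \<Sum>j\<le>n. binc (2 - t) j *\<^sub>R (T ^^ j) (fpow T (a + 2) x)) \<longlonglongrightarrow> fpow T (a + t) x" for x
    using assms by (intro fpow_down_two) auto
qed (use assms in auto)

lemma sq_le:
  assumes "a > 0" "b > 0"
    and R: "R_bounded ((\<lambda>n. \<lambda>x. real n *\<^sub>R ((T ^^ n) x - (T ^^ (n - 1)) x)) ` {1..})"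
  shows "sq_le T b a"
proof -
  \<comment> \<open>Raising \<open>b\<close> by at least \<open>a\<close> makes the gap
    \<open>d\<close> positive, so that it splits into an integer and a remainder in
    \<open>(0, 1]\<close>.\<close>
  define n2 where "n2 = nat \<lceil>a\<rceil>"
  define d where "d = b + real n2 - a"
  have d: "d > 0" using assms by (simp add: d_def n2_def) linarith
  \<comment> \<open>The ceiling minus 1, instead of the floor, keeps \<open>t\<close> away from 0
    when \<open>d\<close> is an integer; \<open>sq_le_down_frac\<close> requires 0 < t \<le>
    1.\<close>
  define n1 where "n1 = nat (\<lceil>d\<rceil> - 1)"
  define t where "t = d - real n1"
  have "real n1 = of_int \<lceil>d\<rceil> - 1" using d by (simp add: n1_def)
  then have t: "0 < t" "t \<le> 1" by (auto simp: t_def) linarith+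
  have "sq_le T b (b + real n2)" by (rule sq_le_down_nat) fact
  also have "b + real n2 = (a + real n1) + t" by (simp add: t_def d_def)
  finally have "sq_le T b ((a + real n1) + t)" .
  moreover have "sq_le T ((a + real n1) + t) ((a + real n1) + 2)"
    using assms t by (intro sq_le_down_frac) auto
  moreover have "sq_le T ((a + real n1) + 2) a"
    using sq_le_up[OF assms(1) R, of "n1 + 2"] by (simp add: add_ac)
  ultimately show ?thesis using sq_le_trans by blast
qed

end

text \<open>A Rademacher sum with one term has the norm of that term, so R-boundedness contains a
  uniform operator norm bound.\<close>

lemma R_Ritt_imp_ritt:
  assumes "R_Ritt T"
  obtains C where "ritt T C"
proof -
  have T: "bounded_linear T" "R_bounded (range (\<lambda>n. T ^^ n))"
    "R_bounded ((\<lambda>n. \<lambda>x. real n *\<^sub>R ((T ^^ n) x - (T ^^ (n - 1)) x)) ` {1..})"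
    using assms by (auto simp: R_Ritt_def)
  have one: "\<exists>C\<ge>1. \<forall>Q\<in>F. \<forall>x. norm (Q x) \<le> C * norm x" if F: "R_bounded F" for F :: "('a \<Rightarrow> 'a) set"
  proof -
    obtain C where C: "C \<ge> 1" "\<forall>K Q y. finite K \<longrightarrow> (\<forall>k\<in>K. Q k \<in> F) \<longrightarrow>
        rad_norm K (\<lambda>k. Q k (y k)) \<le> C * rad_norm K y"
      using R_bounded_finite_sets[OF F] by blast
    have "norm (Q x) \<le> C * norm x" if "Q \<in> F" for Q x
      using C(2)[rule_format, of "{0}" "\<lambda>_. Q" "\<lambda>_. x"] that by (simp add: rad_norm_singleton)
    then show ?thesis using C(1) by blast
  qed
  obtain C where C: "C \<ge> 1" "\<And>n x. norm ((T ^^ n) x) \<le> C * norm x"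
    using one[OF T(2)] by auto
  obtain D where D: "D \<ge> 1" "\<And>n x. n \<ge> 1 \<Longrightarrow> norm (real n *\<^sub>R ((T ^^ n) x - (T ^^ (n - 1)) x)) \<le> D * norm x"
    using one[OF T(3)] by fastforce
  have "ritt T (max C D)"
  proof (intro ritt.intro power_bounded.intro ritt_axioms.intro)
    show "bounded_linear T" by fact
    show "norm ((T ^^ n) x) \<le> max C D * norm x" for n x
      using C(2)[of n x] mult_right_mono[of C "max C D" "norm x"] by simp
    show "norm (real n *\<^sub>R ((T ^^ n) x - (T ^^ (n - 1)) x)) \<le> max C D * norm x" for n x
    proof (cases "n = 0")
      case False
      then show ?thesis
        using D(2)[of n x] mult_right_mono[of D "max C D" "norm x"] by simp
    qed (use C(1) in simp)
  qed
  then show thesis by (rule that)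
qed

theorem theorem6p1:
  fixes T :: "'a::banach \<Rightarrow> 'a" and \<alpha> \<beta> :: real
  assumes "reflexive_space TYPE('a)"
    and "finite_cotype TYPE('a)"
    and "R_Ritt T"
    and "\<alpha> > 0" and "\<beta> > 0"
  shows "\<exists>C::real. C \<ge> 1 \<and> (\<forall>x::'a.
           ereal (1 / C) * sq_norm T \<alpha> x \<le> sq_norm T \<beta> x \<and>
           sq_norm T \<beta> x \<le> ereal C * sq_norm T \<alpha> x)"
proof -
  obtain B where "ritt T B"
    using R_Ritt_imp_ritt[OF \<open>R_Ritt T\<close>] .
  then interpret ritt T B .
  have R: "R_bounded ((\<lambda>n. \<lambda>x. real n *\<^sub>R ((T ^^ n) x - (T ^^ (n - 1)) x)) ` {1..})"
    using \<open>R_Ritt T\<close> by (simp add: R_Ritt_def)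
  obtain C where C: "C > 0" "\<And>x. sq_norm T \<beta> x \<le> ereal C * sq_norm T \<alpha> x"
    using sq_le[OF \<open>\<alpha> > 0\<close> \<open>\<beta> > 0\<close> R] by (auto simp: sq_le_def)
  obtain D where D: "D > 0" "\<And>x. sq_norm T \<alpha> x \<le> ereal D * sq_norm T \<beta> x"
    using sq_le[OF \<open>\<beta> > 0\<close> \<open>\<alpha> > 0\<close> R] by (auto simp: sq_le_def)
  define E where "E = max 1 (max C D)"
  have E: "E \<ge> 1" "C \<le> E" "D \<le> E" by (auto simp: E_def)
  \<comment> \<open>Enlarging a constant to \<open>E\<close> is monotone only on nonnegative
    extended reals; an infinite \<open>sq_norm\<close> is covered as well.\<close>
  have nonneg: "0 \<le> sq_norm T a x" if "a > 0" for a x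
  proof -
    have "0 \<le> lim (\<lambda>N. rad_norm {1..N} y)" if "rad_cauchy y" for y :: "nat \<Rightarrow> 'a"
      using rad_cauchy_LIMSEQ(2)[OF that, of 0] by simp
    then show ?thesis by (simp add: sq_norm_eq[OF that])
  qed
  show ?thesis
  proof (intro exI[of _ E] conjI allI)
    fix x
    have "sq_norm T \<alpha> x \<le> ereal E * sq_norm T \<beta> x"
      using D(2)[of x] E ereal_mult_right_mono[of "ereal D" "ereal E" "sq_norm T \<beta> x"]
        nonneg[OF \<open>\<beta> > 0\<close>, of x] by (meson ereal_less_eq(3) order.trans)
    then have "ereal (1 / E) * sq_norm T \<alpha> x \<le> ereal (1 / E) * (ereal E * sq_norm T \<beta> x)"
      using E by (intro ereal_mult_left_mono) auto
    also have "\<dots> = sq_norm T \<beta> x"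
      using E by (simp add: mult.assoc[symmetric] flip: one_ereal_def)
    finally show "ereal (1 / E) * sq_norm T \<alpha> x \<le> sq_norm T \<beta> x" .
    show "sq_norm T \<beta> x \<le> ereal E * sq_norm T \<alpha> x"
      using C(2)[of x] E ereal_mult_right_mono[of "ereal C" "ereal E" "sq_norm T \<alpha> x"]
        nonneg[OF \<open>\<alpha> > 0\<close>, of x] by (meson ereal_less_eq(3) order.trans)
  qed (rule E(1))
qed

end
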